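(* Let $G=(V,F,P)$ be a code loop with power map $P$. (1) Let $H_0=G,H_1,\dots,H_s$ be a sequence of loops, where $H_{i+1}$ is obtained from $H_i$ by the cyclic or the dihedral construction, for $i=0,\dots,s-1$. If $\operatorname{Rad}P_3$ is trivial, then $H_s$ is a code loop with power map $R:V\to F$ satisfying $\operatorname{cdeg}(R-P)\le 2$. (2) Whether $\operatorname{Rad}P_3$ is trivial or not, every code loop $H=(V,F,R)$ with power map $R:V\to F$ satisfying $\operatorname{cdeg}(R-P)\le 2$ can be obtained (up to isomorphism) from $H_0=G$ as the last term $H_s$ of such a sequence.
   Context: A Moufang loop is a loop satisfying $((xy)x)z=x(y(xz))$. In a loop, the associator $[x,y,z]$ is the unique $w$ with $(xy)z=(x(yz))w$ and the commutator $[x,y]$ is the unique $w$ with $xy=(yx)w$. For a Moufang loop $G$: $N(G)=\{x:[x,y,z]=1\ \forall y,z\}$ (nucleus), $Z(G)=\{x:[x,y]=[x,y,z]=1\ \forall y,z\}$ (center). The constructions. Let $m\ge 1$, $M=\{-m+1,\dots,m\}$, and $\sigma:\mathbb Z\to\{-1,0,1\}$ with $\sigma(i)=1$ if $i>m$, $0$ if $i\in M$, $-1$ if $i<1-m$. Cyclic construction: let $G$ be a Moufang loop, $S\unlhd G$ with $G/S=\langle\alpha\rangle$ cyclic of order $2m$, and $1\ne h\in S\cap Z(G)$. Then $(G,* )$ is given by $x*y=xy\,h^{\sigma(i+j)}$ for $x\in\alpha^i$, $y\in\alpha^j$, $i,j\in M$. Dihedral construction: let $G$ be a Moufang loop, $S\unlhd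 G$ with $G/S$ dihedral of order $4m$ (for $m=1$ this means the Klein four-group), $\beta,\gamma$ involutions of $G/S$ such that $\alpha=\beta\gamma$ has order $2m$; with $G_0=\bigcup_{i\in M}\alpha^i$, $G_1=G\setminus G_0$, let $1\neq h\in S\cap Z(G_0)\cap N(G)$ with $hxh=x$ for some (equivalently every) $x\in G_1$. Choosing $e\in\beta$, $f\in\gamma$, $(G,* )$ is given by $x*y=xy\,h^{(-1)^r\sigma(i+j)}$ for $x\in\alpha^i\cup e\alpha^i$, $y\in(\alpha^j\cup\alpha^jf)\cap G_r$, $i,j\in M$, $r\in\{0,1\}$ (independent of $e,f$). Code loops. A finite loop $G$ is symplectic if it has a central subloop $Z$ of order $2$ with $G/Z$ an elementary abelian $2$-group. Identify $Z$ with $F=GF(2)$ and $G/Z$ with a finite vector space $V$ over $F$. The power map $P:V\to F$, commutator map $C:V^2\to F$ and associator map $A:V^3\to F$ are given by $P(aZ)=a^2$, $C(aZ,bZ)=[a,b]$, $A(aZ,bZ,cZ)=[a,b,c]$. For $f:V\to F$ with $f(0)=0$ the $n$th derived form is $f_n(v_1,\dots,v_n)=\sum f(v_{i_1}+\dots+v_{i_k})$, summed over all nonempty subsets $\{i_1,\dots,i_k\}\subseteq\{1,\dots,n\}$; the combinatorial degree $\operatorname{cdeg}f$ is the least $n\ge 0$ with $f_{n+1}=0$. A symplectic loop is a code loop if $\operatorname{cdeg}P\le 3$, $C=P_2$ and $A=P_3$; it is then determined up to isomorphism by $P$ and denoted $(V,F,P)$. The radical of $P_3$ is $\operatorname{Rad}P_3=\{v\in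 V: P_3(v,v_2,v_3)=0\ \forall v_2,v_3\in V\}$; it is trivial if it is zero. In part (1), the loops $H_i$ share the underlying set of $G$ and the central subloop $F$, and $H_i/F=G/F=V$. *)

theory Defs
  imports "HOL-Algebra.Multiplicative_Group" "HOL-Library.Z2"
begin

text \<open>
  Loops are carried by the \<^typ>\<open>'a monoid\<close> records of the algebra library, whose operations
  (cosets, factor structure \<open>G Mod S\<close>, \<open>hom\<close>, \<open>iso\<close>, \<open>order\<close>, powers) do not presuppose
  associativity.
\<close>

locale loop =
  fixes G (structure)
  assumes loop_m_closed: "\<lbrakk>x \<in> carrier G; y \<in> carrier G\<rbrakk> \<Longrightarrow> x \<otimes> y \<in> carrier G"
    and loop_one_closed: "\<one> \<in> carrier G"
    and loop_l_one: "x \<in> carrier G \<Longrightarrow> \<one> \<otimes> x = x"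
    and loop_r_one: "x \<in> carrier G \<Longrightarrow> x \<otimes> \<one> = x"
    and loop_left_division:
      "\<lbrakk>a \<in> carrier G; b \<in> carrier G\<rbrakk> \<Longrightarrow> \<exists>!x. x \<in> carrier G \<and> a \<otimes> x = b"
    and loop_right_division:
      "\<lbrakk>a \<in> carrier G; b \<in> carrier G\<rbrakk> \<Longrightarrow> \<exists>!y. y \<in> carrier G \<and> y \<otimes> a = b"

locale moufang_loop = loop +
  assumes moufang:
    "\<lbrakk>x \<in> carrier G; y \<in> carrier G; z \<in> carrier G\<rbrakk>
      \<Longrightarrow> ((x \<otimes> y) \<otimes> x) \<otimes> z = x \<otimes> (y \<otimes> (x \<otimes> z))"

definition loop_associator :: "('a, 'b) monoid_scheme \<Rightarrow> 'a \<Rightarrow> 'a \<Rightarrow> 'a \<Rightarrow> 'a" where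
  "loop_associator G x y z =
    (THE w. w \<in> carrier G \<and> (x \<otimes>\<^bsub>G\<^esub> y) \<otimes>\<^bsub>G\<^esub> z = (x \<otimes>\<^bsub>G\<^esub> (y \<otimes>\<^bsub>G\<^esub> z)) \<otimes>\<^bsub>G\<^esub> w)"

definition loop_commutator :: "('a, 'b) monoid_scheme \<Rightarrow> 'a \<Rightarrow> 'a \<Rightarrow> 'a" where
  "loop_commutator G x y =
    (THE w. w \<in> carrier G \<and> x \<otimes>\<^bsub>G\<^esub> y = (y \<otimes>\<^bsub>G\<^esub> x) \<otimes>\<^bsub>G\<^esub> w)"

text \<open>Nucleus and center in the form appropriate for Moufang loops.\<close>

definition nucleus :: "('a, 'b) monoid_scheme \<Rightarrow> 'a set" where
  "nucleus G = {x \<in> carrier G.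
    \<forall>y\<in>carrier G. \<forall>z\<in>carrier G. loop_associator G x y z = \<one>\<^bsub>G\<^esub>}"

definition loop_center :: "('a, 'b) monoid_scheme \<Rightarrow> 'a set" where
  "loop_center G = {x \<in> carrier G. \<forall>y\<in>carrier G. \<forall>z\<in>carrier G.
    loop_commutator G x y = \<one>\<^bsub>G\<^esub> \<and> loop_associator G x y z = \<one>\<^bsub>G\<^esub>}"

definition subloop :: "'a set \<Rightarrow> ('a, 'b) monoid_scheme \<Rightarrow> bool" where
  "subloop S G \<longleftrightarrow> S \<subseteq> carrier G \<and> loop (G\<lparr>carrier := S\<rparr>)"

definition normal_subloop :: "'a set \<Rightarrow> ('a, 'b) monoid_scheme \<Rightarrow> bool" where
  "normal_subloop S G \<longleftrightarrow> subloop S G \<and>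
    (\<forall>x\<in>carrier G. \<forall>y\<in>carrier G.
      x <#\<^bsub>G\<^esub> S = S #>\<^bsub>G\<^esub> x \<and>
      (x <#\<^bsub>G\<^esub> S) #>\<^bsub>G\<^esub> y = x <#\<^bsub>G\<^esub> (S #>\<^bsub>G\<^esub> y) \<and>
      x <#\<^bsub>G\<^esub> (y <#\<^bsub>G\<^esub> S) = (x \<otimes>\<^bsub>G\<^esub> y) <#\<^bsub>G\<^esub> S)"

text \<open>
  In a loop that is not known to be Moufang, a central element has to associate from each of the
  three positions; in Moufang loops the last two conditions are redundant.
\<close>

definition central_subloop :: "'a set \<Rightarrow> ('a, 'b) monoid_scheme \<Rightarrow> bool" where
  "central_subloop Z G \<longleftrightarrow> subloop Z G \<and> Z \<subseteq> loop_center G \<and>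
    (\<forall>z\<in>Z. \<forall>x\<in>carrier G. \<forall>y\<in>carrier G.
      loop_associator G x z y = \<one>\<^bsub>G\<^esub> \<and> loop_associator G x y z = \<one>\<^bsub>G\<^esub>)"


section \<open>The cyclic and dihedral constructions\<close>

definition construction_range :: "nat \<Rightarrow> int set" where
  "construction_range m = {- int m + 1..int m}"

definition construction_sigma :: "nat \<Rightarrow> int \<Rightarrow> int" where
  "construction_sigma m i = (if i > int m then 1 else if i < 1 - int m then -1 else 0)"

text \<open>
  \<open>H\<close> is the loop \<open>(G, *)\<close>. The multiplication of \<open>H\<close> is prescribed on the carrier only, since its
  values elsewhere carry no information. Elements of \<open>G Mod S\<close> are subsets of \<open>carrier G\<close>,
  so that membership in the coset \<open>\<alpha>\<^sup>i\<close> is literal.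
\<close>

definition cyclic_construction ::
  "nat \<Rightarrow> 'a set \<Rightarrow> 'a set \<Rightarrow> 'a \<Rightarrow> 'a monoid \<Rightarrow> 'a monoid \<Rightarrow> bool" where
  "cyclic_construction m S \<alpha> h G H \<longleftrightarrow>
    1 \<le> m \<and> moufang_loop G \<and> normal_subloop S G \<and>
    group (G Mod S) \<and> \<alpha> \<in> carrier (G Mod S) \<and>
    carrier (G Mod S) = generate (G Mod S) {\<alpha>} \<and> order (G Mod S) = 2 * m \<and>
    h \<in> S \<inter> loop_center G \<and> h \<noteq> \<one>\<^bsub>G\<^esub> \<and>
    carrier H = carrier G \<and> \<one>\<^bsub>H\<^esub> = \<one>\<^bsub>G\<^esub> \<and>
    (\<forall>i\<in>construction_range m. \<forall>j\<in>construction_range m.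
      \<forall>x \<in> \<alpha> [^]\<^bsub>G Mod S\<^esub> i. \<forall>y \<in> \<alpha> [^]\<^bsub>G Mod S\<^esub> j.
        x \<otimes>\<^bsub>H\<^esub> y = (x \<otimes>\<^bsub>G\<^esub> y) \<otimes>\<^bsub>G\<^esub> (h [^]\<^bsub>G\<^esub> construction_sigma m (i + j)))"

text \<open>Dihedral of order \<open>2 * n\<close>; for \<open>n = 2\<close> this is the Klein four-group.\<close>

definition dihedral_group :: "('a, 'b) monoid_scheme \<Rightarrow> nat \<Rightarrow> bool" where
  "dihedral_group D n \<longleftrightarrow> group D \<and> order D = 2 * n \<and>
    (\<exists>\<rho>\<in>carrier D. \<exists>\<tau>\<in>carrier D.
      carrier D = generate D {\<rho>, \<tau>} \<and> group.ord D \<rho> = n \<and>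
      \<tau> \<otimes>\<^bsub>D\<^esub> \<tau> = \<one>\<^bsub>D\<^esub> \<and> (\<tau> \<otimes>\<^bsub>D\<^esub> \<rho>) \<otimes>\<^bsub>D\<^esub> \<tau> = inv\<^bsub>D\<^esub> \<rho>)"

definition involution :: "('a, 'b) monoid_scheme \<Rightarrow> 'a \<Rightarrow> bool" where
  "involution D \<beta> \<longleftrightarrow> \<beta> \<in> carrier D \<and> \<beta> \<noteq> \<one>\<^bsub>D\<^esub> \<and> \<beta> \<otimes>\<^bsub>D\<^esub> \<beta> = \<one>\<^bsub>D\<^esub>"

definition dihedral_construction ::
  "nat \<Rightarrow> 'a set \<Rightarrow> 'a set \<Rightarrow> 'a set \<Rightarrow> 'a \<Rightarrow> 'a \<Rightarrow> 'a \<Rightarrow> 'a monoid \<Rightarrow> 'a monoid \<Rightarrow> bool" where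
  "dihedral_construction m S \<beta> \<gamma> h e f G H \<longleftrightarrow>
    (let \<alpha> = \<beta> \<otimes>\<^bsub>G Mod S\<^esub> \<gamma>;
         pw = (\<lambda>i::int. \<alpha> [^]\<^bsub>G Mod S\<^esub> i);
         M = construction_range m;
         G0 = (\<Union>i\<in>M. pw i);
         G1 = carrier G - G0
     in 1 \<le> m \<and> moufang_loop G \<and> normal_subloop S G \<and>
        dihedral_group (G Mod S) (2 * m) \<and>
        involution (G Mod S) \<beta> \<and> involution (G Mod S) \<gamma> \<and>
        group.ord (G Mod S) \<alpha> = 2 * m \<and>
        h \<in> S \<inter> loop_center (G\<lparr>carrier := G0\<rparr>) \<inter> nucleus G \<and> h \<noteq> \<one>\<^bsub>G\<^esub> \<and>
        (\<exists>x\<in>G1. (h \<otimes>\<^bsub>G\<^esub> x) \<otimes>\<^bsub>G\<^esub> h = x) \<and>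
        e \<in> \<beta> \<and> f \<in> \<gamma> \<and>
        carrier H = carrier G \<and> \<one>\<^bsub>H\<^esub> = \<one>\<^bsub>G\<^esub> \<and>
        (\<forall>i\<in>M. \<forall>j\<in>M. \<forall>r\<in>{0, 1::nat}.
          \<forall>x \<in> pw i \<union> (e <#\<^bsub>G\<^esub> pw i).
          \<forall>y \<in> (pw j \<union> (pw j #>\<^bsub>G\<^esub> f)) \<inter> (if r = 0 then G0 else G1).
            x \<otimes>\<^bsub>H\<^esub> y =
              (x \<otimes>\<^bsub>G\<^esub> y) \<otimes>\<^bsub>G\<^esub> (h [^]\<^bsub>G\<^esub> ((-1) ^ r * construction_sigma m (i + j)))))"

definition obtained_by_construction :: "'a monoid \<Rightarrow> 'a monoid \<Rightarrow> bool" where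
  "obtained_by_construction G H \<longleftrightarrow>
    (\<exists>m S \<alpha> h. cyclic_construction m S \<alpha> h G H) \<or>
    (\<exists>m S \<beta> \<gamma> h e f. dihedral_construction m S \<beta> \<gamma> h e f G H)"

definition construction_sequence :: "'a monoid \<Rightarrow> nat \<Rightarrow> (nat \<Rightarrow> 'a monoid) \<Rightarrow> bool" where
  "construction_sequence G s H \<longleftrightarrow>
    H 0 = G \<and> (\<forall>i<s. obtained_by_construction (H i) (H (Suc i)))"


section \<open>Derived forms\<close>

text \<open>
  A vector space over GF(2) is represented by its additive group \<open>V\<close>, an elementary abelian
  2-group written multiplicatively. The arguments of the \<open>n\<close>-th derived form are given by a list
  of length \<open>n\<close>.
\<close>

definition elementary_abelian_2_group :: "('v, 'b) monoid_scheme \<Rightarrow> bool" where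
  "elementary_abelian_2_group V \<longleftrightarrow>
    comm_group V \<and> (\<forall>v\<in>carrier V. v \<otimes>\<^bsub>V\<^esub> v = \<one>\<^bsub>V\<^esub>)"

definition derived_form :: "('v, 'b) monoid_scheme \<Rightarrow> ('v \<Rightarrow> bit) \<Rightarrow> 'v list \<Rightarrow> bit" where
  "derived_form V f vs =
    (\<Sum>I | I \<subseteq> {..<length vs} \<and> I \<noteq> {}. f (finprod V (\<lambda>i. vs ! i) I))"

definition cdeg :: "('v, 'b) monoid_scheme \<Rightarrow> ('v \<Rightarrow> bit) \<Rightarrow> nat" where
  "cdeg V f = (LEAST n. \<forall>vs. length vs = Suc n \<and> set vs \<subseteq> carrier V \<longrightarrow> derived_form V f vs = 0)"

definition radical3 :: "('v, 'b) monoid_scheme \<Rightarrow> ('v \<Rightarrow> 'v \<Rightarrow> 'v \<Rightarrow> bit) \<Rightarrow> 'v set" where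
  "radical3 V A = {v \<in> carrier V. \<forall>v2\<in>carrier V. \<forall>v3\<in>carrier V. A v v2 v3 = 0}"


section \<open>Symplectic loops and code loops\<close>

definition symplectic_loop :: "('a, 'b) monoid_scheme \<Rightarrow> 'a set \<Rightarrow> bool" where
  "symplectic_loop G Z \<longleftrightarrow> loop G \<and> finite (carrier G) \<and>
    central_subloop Z G \<and> card Z = 2 \<and> elementary_abelian_2_group (G Mod Z)"

text \<open>The identification of the central subloop of order 2 with GF(2).\<close>

definition to_gf2 :: "('a, 'b) monoid_scheme \<Rightarrow> 'a \<Rightarrow> bit" where
  "to_gf2 G z = (if z = \<one>\<^bsub>G\<^esub> then 0 else 1)"

text \<open>
  In a symplectic loop the images below are singletons, because squares, commutators and
  associators lie in \<open>Z\<close> and depend only on the cosets modulo \<open>Z\<close>.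
\<close>

definition power_map :: "('a, 'b) monoid_scheme \<Rightarrow> 'a set \<Rightarrow> bit" where
  "power_map G u = the_elem ((\<lambda>a. to_gf2 G (a \<otimes>\<^bsub>G\<^esub> a)) ` u)"

definition commutator_map :: "('a, 'b) monoid_scheme \<Rightarrow> 'a set \<Rightarrow> 'a set \<Rightarrow> bit" where
  "commutator_map G u v =
    the_elem ((\<lambda>(a, b). to_gf2 G (loop_commutator G a b)) ` (u \<times> v))"

definition associator_map :: "('a, 'b) monoid_scheme \<Rightarrow> 'a set \<Rightarrow> 'a set \<Rightarrow> 'a set \<Rightarrow> bit" where
  "associator_map G u v w =
    the_elem ((\<lambda>(a, b, c). to_gf2 G (loop_associator G a b c)) ` (u \<times> v \<times> w))"

definition code_loop :: "('a, 'b) monoid_scheme \<Rightarrow> 'a set \<Rightarrow> bool" where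
  "code_loop G Z \<longleftrightarrow> symplectic_loop G Z \<and>
    cdeg (G Mod Z) (power_map G) \<le> 3 \<and>
    (\<forall>u\<in>carrier (G Mod Z). \<forall>v\<in>carrier (G Mod Z).
      commutator_map G u v = derived_form (G Mod Z) (power_map G) [u, v]) \<and>
    (\<forall>u\<in>carrier (G Mod Z). \<forall>v\<in>carrier (G Mod Z). \<forall>w\<in>carrier (G Mod Z).
      associator_map G u v w = derived_form (G Mod Z) (power_map G) [u, v, w])"

text \<open>
  \<open>H\<close> is a code loop \<open>(V, F, R)\<close>: its factor by the central subloop can be identified with \<open>V\<close>
  in such a way that the power map becomes \<open>R\<close>.
\<close>

definition is_code_loop_VFP ::
  "('a, 'b) monoid_scheme \<Rightarrow> ('v, 'c) monoid_scheme \<Rightarrow> ('v \<Rightarrow> bit) \<Rightarrow> bool" where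
  "is_code_loop_VFP H V R \<longleftrightarrow>
    (\<exists>W \<phi>. code_loop H W \<and> \<phi> \<in> iso V (H Mod W) \<and> (\<forall>v\<in>carrier V. R v = power_map H (\<phi> v)))"

text \<open>Equality of two loops, disregarding the values of the multiplications off the carrier.\<close>

definition same_loop :: "('a, 'b) monoid_scheme \<Rightarrow> ('a, 'c) monoid_scheme \<Rightarrow> bool" where
  "same_loop K L \<longleftrightarrow> carrier K = carrier L \<and> \<one>\<^bsub>K\<^esub> = \<one>\<^bsub>L\<^esub> \<and>
    (\<forall>x\<in>carrier K. \<forall>y\<in>carrier K. x \<otimes>\<^bsub>K\<^esub> y = x \<otimes>\<^bsub>L\<^esub> y)"

end

theory Submission
  imports Defs "HOL-Library.Product_Plus"
begin

text \<open>
  If the radical is trivial, then the nucleus of a code loop is its central subloop \<open>{1, z}\<close>, so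
  that \<open>h = z\<close> and \<open>z \<in> S\<close>. Hence \<open>G / S\<close> has exponent two, which forces \<open>m = 1\<close>, and both
  constructions amount to \<open>x * y = xy z\<^bsup>\<lambda>(x)\<mu>(y)\<^esup>\<close> with linear forms \<open>\<lambda>\<close>, \<open>\<mu>\<close> on \<open>V\<close>, where
  \<open>\<lambda> = \<mu>\<close> in the cyclic case. This adds \<open>\<lambda>\<mu>\<close> to the power map and preserves the associators.
  Conversely, every product \<open>\<lambda>\<mu>\<close> arises in this way, a form of combinatorial degree at most two
  is a sum of such products, and a code loop is determined by its power map because two cocycles
  with the same power map differ by a symmetric cocycle with zero diagonal, which is a coboundary.
\<close>

section \<open>Derived forms and quadratic forms on elementary abelian 2-groups\<close>

text \<open>The nucleus is small because \<open>as_eq\<close> identifies the associator with P_3: if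
  all [h, x, y] are 1, the class of h lies in the radical. Next, m = 1 because squares lie in {1,
  z}, so with z in S the quotient has exponent two, whereas \<open>\<alpha>\<close> has order 2m.
  The exponents i, j then run over 0 and 1, where sigma(i + j) is the product ij; the two linear
  forms are the ones that read i and j off the cosets, and z being its own inverse absorbs the sign
  (-1)^r. A product of linear forms is a bilinear form g, hence a 2-cocycle. Twisting by it leaves
  associators alone, adds g(v, v) to the squares and g(u, v) + g(v, u) to the commutators, which is
  exactly the polarization of g(v, v); so C = P_2 and A = P_3 survive. As P_3 does not change,
  neither does its radical, and the hypothesis on G is again available at every later loop of a
  sequence. All loops of a sequence live on one set, but each has its own quotient record modulo Z.
  These records are compared on the carrier only, by \<open>same_loop\<close>.\<close>

declare add_bit_eq_xor [simp del] mult_bit_eq_and [simp del]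

lemma bit_add_self [simp]: "(a::bit) + a = 0"
  by (cases a) (simp_all add: add_bit_eq_xor)

lemma bit_add_self_left [simp]: "(a::bit) + (a + b) = b"
  by (simp flip: add.assoc)

lemma bit_mult_self [simp]: "(a::bit) * a = a"
  by (cases a) simp_all

lemma bit_add_eq_0_iff [simp]: "(a::bit) + b = 0 \<longleftrightarrow> a = b"
  by (metis add.right_neutral bit_add_self bit_add_self_left)

text \<open>A variant of \<open>derived_form\<close> that includes the empty subproduct: each
  subproduct either omits or contains the first vector, which gives a uniform recursion. The two
  differ by the value of \<open>f\<close> at the identity.\<close>

primrec dsum :: "('v, 'c) monoid_scheme \<Rightarrow> ('v \<Rightarrow> bit) \<Rightarrow> 'v list \<Rightarrow> bit" where
  "dsum V f [] = f \<one>\<^bsub>V\<^esub>"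
| "dsum V f (v # vs) = dsum V f vs + dsum V (\<lambda>x. f (v \<otimes>\<^bsub>V\<^esub> x)) vs"

locale elem_ab2 = comm_group V for V (structure) +
  assumes m_self: "v \<in> carrier V \<Longrightarrow> v \<otimes> v = \<one>"
begin

lemma m_self_left: "\<lbrakk>u \<in> carrier V; v \<in> carrier V\<rbrakk> \<Longrightarrow> u \<otimes> (u \<otimes> v) = v"
  by (simp add: m_self flip: m_assoc)

lemma dsum_cong:
  assumes "\<And>x. x \<in> carrier V \<Longrightarrow> f x = g x" "set vs \<subseteq> carrier V"
  shows "dsum V f vs = dsum V g vs"
  using assms
proof (induction vs arbitrary: f g)
  case (Cons v vs)
  have "dsum V f vs = dsum V g vs"
    using Cons.prems by (intro Cons.IH) auto
  moreover have "dsum V (\<lambda>x. f (v \<otimes> x)) vs = dsum V (\<lambda>x. g (v \<otimes> x)) vs"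
    using Cons.prems by (intro Cons.IH) auto
  ultimately show ?case by simp
qed simp

lemma dsum_add: "dsum V (\<lambda>x. f x + g x) vs = dsum V f vs + dsum V g vs"
  by (induction vs arbitrary: f g) (simp_all add: ac_simps)

text \<open>The subsets of an index range split into those without 0 and those with 0; after
  shifting indices by one, both kinds are indexed by the subsets of the shorter range.\<close>

lemma sum_Pow_eq_dsum:
  assumes "set vs \<subseteq> carrier V"
  shows "(\<Sum>I\<in>Pow {..<length vs}. f (finprod V (\<lambda>i. vs ! i) I)) = dsum V f vs"
  using assms
proof (induction vs arbitrary: f)
  case (Cons v vs)
  let ?n = "length vs"
  let ?p = "finprod V (\<lambda>i. (v # vs) ! i)"
  have nth: "vs ! i \<in> carrier V" if "i < ?n" for i
    using that Cons.prems by auto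
  have shift: "?p (Suc ` I) = finprod V (\<lambda>i. vs ! i) I" if "I \<subseteq> {..<?n}" for I
  proof -
    have "?p (Suc ` I) = finprod V (\<lambda>i. (v # vs) ! Suc i) I"
      using that nth by (intro finprod_reindex) auto
    then show ?thesis by simp
  qed
  have ins: "?p (insert 0 (Suc ` I)) = v \<otimes> finprod V (\<lambda>i. vs ! i) I" if "I \<subseteq> {..<?n}" for I
  proof -
    have "?p (insert 0 (Suc ` I)) = (v # vs) ! 0 \<otimes> ?p (Suc ` I)"
      using that nth Cons.prems finite_subset[OF that] by (intro finprod_insert) auto
    then show ?thesis using shift[OF that] by simp
  qed
  have inj0: "inj_on (insert 0) (Pow (Suc ` {..<?n}))"
    by (auto simp: inj_on_def)
  have inj1: "inj_on (image Suc) (Pow {..<?n})"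
    by (rule inj_on_image_Pow) simp
  have insert_eq: "(\<Sum>I\<in>Pow {..<?n}. f (?p (insert 0 (Suc ` I))))
      = (\<Sum>I\<in>Pow {..<?n}. f (v \<otimes> finprod V (\<lambda>i. vs ! i) I))"
    by (intro sum.cong refl) (simp only: Pow_iff ins)
  have shift_eq: "(\<Sum>I\<in>Pow {..<?n}. f (?p (Suc ` I)))
      = (\<Sum>I\<in>Pow {..<?n}. f (finprod V (\<lambda>i. vs ! i) I))"
    by (intro sum.cong refl) (simp only: Pow_iff shift)
  have Pow_Suc: "Pow (Suc ` {..<?n}) = image Suc ` Pow {..<?n}"
    by (simp add: image_Pow_surj)
  have "(\<Sum>I\<in>Pow {..<length (v # vs)}. f (?p I))
      = (\<Sum>I\<in>Pow (Suc ` {..<?n}). f (?p I)) + (\<Sum>I\<in>insert 0 ` Pow (Suc ` {..<?n}). f (?p I))"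
    unfolding length_Cons lessThan_Suc_eq_insert_0 Pow_insert
    by (rule sum.union_disjoint) auto
  also have "\<dots> = (\<Sum>I\<in>Pow {..<?n}. f (finprod V (\<lambda>i. vs ! i) I))
      + (\<Sum>I\<in>Pow {..<?n}. f (v \<otimes> finprod V (\<lambda>i. vs ! i) I))"
    unfolding sum.reindex[OF inj0] unfolding Pow_Suc sum.reindex[OF inj1] o_def insert_eq shift_eq ..
  also have "\<dots> = dsum V f (v # vs)"
    using Cons.IH[of f] Cons.IH[of "\<lambda>x. f (v \<otimes> x)"] Cons.prems by simp
  finally show ?case .
qed simp

lemma derived_form_eq_dsum:
  assumes "set vs \<subseteq> carrier V"
  shows "derived_form V f vs = dsum V f vs + f \<one>"
proof -
  let ?g = "\<lambda>I. f (finprod V (\<lambda>i. vs ! i) I)"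
  have eq: "{I. I \<subseteq> {..<length vs} \<and> I \<noteq> {}} = Pow {..<length vs} - {{}}"
    by auto
  have "(\<Sum>I\<in>Pow {..<length vs}. ?g I) = ?g {} + (\<Sum>I\<in>Pow {..<length vs} - {{}}. ?g I)"
    by (rule sum.remove) auto
  then show ?thesis
    unfolding derived_form_def eq by (simp add: sum_Pow_eq_dsum[OF assms] ac_simps)
qed

lemma derived_form_single: "v \<in> carrier V \<Longrightarrow> derived_form V f [v] = f v"
  by (simp add: derived_form_eq_dsum ac_simps)

text \<open>The next derived form measures how far the previous one is from being additive in its
  first argument. In the expansion modulo 2, the part using neither \<open>u\<close> nor
  \<open>v\<close> occurs three times on the right, hence once.\<close>

lemma derived_form_rec:
  assumes "u \<in> carrier V" "v \<in> carrier V" "set ws \<subseteq> carrier V"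
  shows "derived_form V f (u # v # ws)
    = derived_form V f (u \<otimes> v # ws) + derived_form V f (u # ws) + derived_form V f (v # ws)"
proof -
  have "dsum V (\<lambda>x. f (v \<otimes> (u \<otimes> x))) ws = dsum V (\<lambda>x. f (u \<otimes> v \<otimes> x)) ws"
    using assms by (intro dsum_cong) (auto simp: m_ac)
  moreover have "dsum V (\<lambda>x. f (u \<otimes> (v \<otimes> x))) ws = dsum V (\<lambda>x. f (u \<otimes> v \<otimes> x)) ws"
    using assms by (intro dsum_cong) (auto simp: m_ac)
  ultimately show ?thesis
    using assms by (simp add: derived_form_eq_dsum ac_simps)
qed

lemma derived_form2:
  assumes "u \<in> carrier V" "v \<in> carrier V"
  shows "derived_form V f [u, v] = f u + f v + f (u \<otimes> v)"
  using assms by (simp add: derived_form_rec derived_form_single ac_simps)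

lemma derived_form3:
  assumes "u \<in> carrier V" "v \<in> carrier V" "w \<in> carrier V"
  shows "derived_form V f [u, v, w]
    = f u + f v + f w + f (u \<otimes> v) + f (u \<otimes> w) + f (v \<otimes> w) + f (u \<otimes> v \<otimes> w)"
  using assms by (simp add: derived_form_rec derived_form_single ac_simps)

text \<open>Subproducts pair off according to whether they contain \<open>u\<close>, and both
  members of a pair give the same value of \<open>f\<close>, so the sum cancels.\<close>

lemma dsum_invariant:
  assumes "u \<in> set vs" "set vs \<subseteq> carrier V" "\<And>x. x \<in> carrier V \<Longrightarrow> f (u \<otimes> x) = f x"
  shows "dsum V f vs = 0"
  using assms
proof (induction vs arbitrary: f)
  case (Cons v vs)
  show ?case
  proof (cases "u = v")
    case True
    then have "dsum V (\<lambda>x. f (v \<otimes> x)) vs = dsum V f vs"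
      using Cons.prems by (intro dsum_cong) auto
    then show ?thesis by simp
  next
    case False
    then have u: "u \<in> set vs" "u \<in> carrier V" "v \<in> carrier V"
      using Cons.prems by auto
    have "f (v \<otimes> (u \<otimes> x)) = f (v \<otimes> x)" if "x \<in> carrier V" for x
      using Cons.prems(3)[of "v \<otimes> x"] that u by (simp add: m_ac)
    then have "dsum V (\<lambda>x. f (v \<otimes> x)) vs = 0"
      using u Cons.prems by (intro Cons.IH) auto
    moreover have "dsum V f vs = 0"
      using u Cons.prems by (intro Cons.IH) auto
    ultimately show ?thesis by simp
  qed
qed simp

text \<open>At a repeated vector v the recursion produces f(x) + f(vx), which is invariant under v
  because v has order at most two; the later occurrence of v then cancels everything.\<close>

lemma dsum_not_distinct:
  assumes "\<not> distinct vs" "set vs \<subseteq> carrier V"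
  shows "dsum V f vs = 0"
  using assms
proof (induction vs arbitrary: f)
  case (Cons v vs)
  show ?case
  proof (cases "v \<in> set vs")
    case True
    have "dsum V (\<lambda>x. f x + f (v \<otimes> x)) vs = 0"
      using True Cons.prems by (intro dsum_invariant[of v]) (auto simp: m_self_left ac_simps)
    then show ?thesis by (simp add: dsum_add)
  next
    case False
    then show ?thesis using Cons by auto
  qed
qed simp

lemma derived_form_vanish_mono:
  assumes "\<forall>vs. length vs = Suc n \<and> set vs \<subseteq> carrier V \<longrightarrow> derived_form V f vs = 0" "n \<le> k"
  shows "\<forall>vs. length vs = Suc k \<and> set vs \<subseteq> carrier V \<longrightarrow> derived_form V f vs = 0"
  using assms(2)
proof (induction k rule: dec_induct)
  case base
  show ?case by (rule assms(1))
next
  case (step k)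
  show ?case
  proof (intro allI impI)
    fix vs assume vs: "length vs = Suc (Suc k) \<and> set vs \<subseteq> carrier V"
    then obtain u v ws where "vs = u # v # ws"
      by (metis Suc_length_conv)
    then show "derived_form V f vs = 0"
      using vs step.IH by (simp add: derived_form_rec)
  qed
qed

text \<open>The \<open>LEAST\<close> in \<open>cdeg\<close> is attained: a list longer than the
  carrier repeats a vector, so some derived form vanishes. By monotonicity, vanishing at one length
  then passes to all greater lengths.\<close>

lemma cdeg_le_iff:
  assumes "finite (carrier V)" "f \<one> = 0"
  shows "cdeg V f \<le> n
    \<longleftrightarrow> (\<forall>vs. length vs = Suc n \<and> set vs \<subseteq> carrier V \<longrightarrow> derived_form V f vs = 0)"
proof
  let ?P = "\<lambda>n. \<forall>vs. length vs = Suc n \<and> set vs \<subseteq> carrier V \<longrightarrow> derived_form V f vs = 0"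
  have "derived_form V f vs = 0" if "length vs = Suc (card (carrier V))" "set vs \<subseteq> carrier V" for vs
  proof -
    have "\<not> distinct vs"
      using that assms(1) by (metis Suc_n_not_le_n card_mono distinct_card)
    then show ?thesis
      using that assms(2) by (simp add: derived_form_eq_dsum dsum_not_distinct)
  qed
  then have "?P (card (carrier V))" by blast
  then have "?P (LEAST n. ?P n)" by (rule LeastI)
  then have "?P (cdeg V f)" by (simp only: cdeg_def)
  then show "\<forall>vs. length vs = Suc n \<and> set vs \<subseteq> carrier V \<longrightarrow> derived_form V f vs = 0"
    if "cdeg V f \<le> n"
    using that by (rule derived_form_vanish_mono)
qed (simp add: cdeg_def Least_le)

lemma cdeg_le_2_iff:
  assumes "finite (carrier V)" "f \<one> = 0"
  shows "cdeg V f \<le> 2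
    \<longleftrightarrow> (\<forall>u\<in>carrier V. \<forall>v\<in>carrier V. \<forall>w\<in>carrier V. derived_form V f [u, v, w] = 0)"
  unfolding cdeg_le_iff[where f = f, OF assms] by (auto simp: numeral_2_eq_2 length_Suc_conv)

text \<open>Vanishing of the fourth derived form is additivity of the third in its first argument,
  by \<open>derived_form_rec\<close>. For code loops this becomes additivity of the
  associator.\<close>

lemma cdeg_le_3_iff:
  assumes "finite (carrier V)" "f \<one> = 0"
  shows "cdeg V f \<le> 3
    \<longleftrightarrow> (\<forall>u\<in>carrier V. \<forall>v\<in>carrier V. \<forall>w\<in>carrier V. \<forall>x\<in>carrier V.
      derived_form V f [u \<otimes> v, w, x] = derived_form V f [u, w, x] + derived_form V f [v, w, x])"
proof -
  have "cdeg V f \<le> 3 \<longleftrightarrow> (\<forall>u\<in>carrier V. \<forall>v\<in>carrier V. \<forall>w\<in>carrier V. \<forall>x\<in>carrier V.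
      derived_form V f [u, v, w, x] = 0)"
    unfolding cdeg_le_iff[where f = f, OF assms] by (auto simp: numeral_3_eq_3 length_Suc_conv)
  also have "\<dots> \<longleftrightarrow> (\<forall>u\<in>carrier V. \<forall>v\<in>carrier V. \<forall>w\<in>carrier V. \<forall>x\<in>carrier V.
      derived_form V f [u \<otimes> v, w, x] = derived_form V f [u, w, x] + derived_form V f [v, w, x])"
    by (intro ball_cong refl, subst derived_form_rec) (simp_all add: add.assoc)
  finally show ?thesis .
qed

end

lemma elem_ab2_iff: "elementary_abelian_2_group V \<longleftrightarrow> elem_ab2 V"
  by (auto simp: elementary_abelian_2_group_def elem_ab2_def elem_ab2_axioms_def)

section \<open>Linear forms, quadratic forms and symmetric cocycles over GF(2)\<close>

definition linear_form :: "('v, 'c) monoid_scheme \<Rightarrow> ('v \<Rightarrow> bit) \<Rightarrow> bool" where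
  "linear_form V l \<longleftrightarrow>
    (\<forall>u\<in>carrier V. \<forall>v\<in>carrier V. l (u \<otimes>\<^bsub>V\<^esub> v) = l u + l v)"

text \<open>Generated by products of two linear forms because each such product is what one
  construction adds to the power map. Linear terms are included, since l = l * l over GF(2).\<close>

inductive quadratic_form :: "('v, 'c) monoid_scheme \<Rightarrow> ('v \<Rightarrow> bit) \<Rightarrow> bool"
  for V :: "('v, 'c) monoid_scheme" where
  zero: "quadratic_form V (\<lambda>v. 0)"
| add: "\<lbrakk>quadratic_form V q; linear_form V l; linear_form V k\<rbrakk>
    \<Longrightarrow> quadratic_form V (\<lambda>v. q v + l v * k v)"

context elem_ab2
begin

lemma linear_form_one: "linear_form V l \<Longrightarrow> l \<one> = 0"
  unfolding linear_form_def using bit_add_self[of "l \<one>"] by (metis m_self one_closed)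

text \<open>In the third derived form of l * k, a monomial involving one vector occurs in four
  subsets and a monomial involving two vectors in two, so everything cancels modulo 2.\<close>

lemma quadratic_form_derived:
  assumes "quadratic_form V q" "u \<in> carrier V" "v \<in> carrier V" "w \<in> carrier V"
  shows "q \<one> = 0 \<and> derived_form V q [u, v, w] = 0"
  using assms
proof (induction)
  case (add q l k)
  have "derived_form V (\<lambda>v. l v * k v) [u, v, w] = 0"
    using add.prems add.hyps by (simp add: derived_form3 linear_form_def algebra_simps)
  moreover have "derived_form V (\<lambda>v. q v + l v * k v) [u, v, w]
      = derived_form V q [u, v, w] + derived_form V (\<lambda>v. l v * k v) [u, v, w]"
    using add.prems by (simp add: derived_form3 ac_simps)
  ultimately show ?case
    using add by (simp add: linear_form_one)
qed (simp add: derived_form3)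

lemma subgroup_of_closed:
  assumes "U \<subseteq> carrier V" "\<one> \<in> U" "\<And>x y. \<lbrakk>x \<in> U; y \<in> U\<rbrakk> \<Longrightarrow> x \<otimes> y \<in> U"
  shows "subgroup U V"
proof (rule subgroupI)
  show "inv x \<in> U" if "x \<in> U" for x
  proof -
    have "inv x = x" using that assms(1) m_self by (auto intro: inv_equality)
    then show ?thesis using that by simp
  qed
qed (use assms in auto)

lemma subgroup_extend:
  assumes U: "subgroup U V" and b: "b \<in> carrier V"
  shows "subgroup (U \<union> (\<lambda>u. b \<otimes> u) ` U) V"
proof (rule subgroup_of_closed)
  interpret U: subgroup U V by (rule U)
  show "U \<union> (\<lambda>u. b \<otimes> u) ` U \<subseteq> carrier V" using b by auto
  fix x y assume "x \<in> U \<union> (\<lambda>u. b \<otimes> u) ` U" "y \<in> U \<union> (\<lambda>u. b \<otimes> u) ` U"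
  then consider "x \<in> U" "y \<in> U" | m where "x \<in> U" "y = b \<otimes> m" "m \<in> U"
    | m where "x = b \<otimes> m" "m \<in> U" "y \<in> U"
    | m n where "x = b \<otimes> m" "m \<in> U" "y = b \<otimes> n" "n \<in> U"
    by auto
  then show "x \<otimes> y \<in> U \<union> (\<lambda>u. b \<otimes> u) ` U"
  proof cases
    case 2
    then have "x \<otimes> y = b \<otimes> (x \<otimes> m)" using b by (simp add: m_ac)
    then show ?thesis using 2 by auto
  next
    case 3
    then have "x \<otimes> y = b \<otimes> (m \<otimes> y)" using b by (simp add: m_ac)
    then show ?thesis using 3 by auto
  next
    case 4
    then have "x \<otimes> y = b \<otimes> (b \<otimes> (m \<otimes> n))" using b by (simp add: m_ac)
    then show ?thesis using 4 b by (simp add: m_self_left)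
  qed auto
qed (use subgroup.one_closed[OF U] in auto)

text \<open>A subgroup that is maximal among those containing \<open>U\<close> and avoiding \<open>a\<close> has index two.\<close>

lemma ex_separating_linear_form:
  assumes fin: "finite (carrier V)" and U: "subgroup U V" and a: "a \<in> carrier V" "a \<notin> U"
  obtains l where "linear_form V l" "\<And>u. u \<in> U \<Longrightarrow> l u = 0" "l a = 1"
proof -
  let ?P = "\<lambda>M. subgroup M V \<and> U \<subseteq> M \<and> a \<notin> M"
  have "\<exists>M. ?P M \<and> (\<forall>N. ?P N \<longrightarrow> card N \<le> card M)"
    \<comment> \<open>The bound on the cardinalities has to be strict, hence the successor.\<close>
    by (rule ex_has_greatest_nat[where b = "Suc (card (carrier V))"])
      (use U a fin in \<open>auto simp: less_Suc_eq_le intro!: card_mono dest: subgroup.subset\<close>)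
  then obtain M where M: "?P M" and max: "\<And>N. ?P N \<Longrightarrow> card N \<le> card M"
    by blast
  interpret M: subgroup M V using M by blast
  \<comment> \<open>Otherwise M together with its coset by b would be a larger subgroup that still
    avoids a. So the complement of M is a single coset, and its indicator function is the desired
    form.\<close>
  have coset: "a \<otimes> b \<in> M" if b: "b \<in> carrier V" "b \<notin> M" for b
  proof (rule ccontr)
    assume ab: "a \<otimes> b \<notin> M"
    let ?N = "M \<union> (\<lambda>m. b \<otimes> m) ` M"
    have "subgroup ?N V" using M b by (intro subgroup_extend) auto
    moreover have "a \<notin> ?N"
    proof
      assume "a \<in> ?N"
      then obtain m where m: "m \<in> M" "a = b \<otimes> m" using M by auto
      then have "a \<otimes> b = b \<otimes> (b \<otimes> m)" using b by (simp add: m_ac)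
      then show False using ab b m by (simp add: m_self_left)
    qed
    ultimately have "card ?N \<le> card M" using M max by blast
    moreover have "card M < card ?N"
    proof (rule psubset_card_mono)
      show "finite ?N" using M.subset fin by (simp add: finite_subset)
      have "b = b \<otimes> \<one>" using b by simp
      then have "b \<in> ?N" using M.one_closed by blast
      then show "M \<subset> ?N" using b by blast
    qed
    ultimately show False by simp
  qed
  let ?l = "\<lambda>v. if v \<in> M then 0 else (1::bit)"
  have "linear_form V ?l"
    unfolding linear_form_def
  proof (intro ballI)
    fix u v assume uv: "u \<in> carrier V" "v \<in> carrier V"
    have in_iff: "x \<otimes> y \<in> M \<longleftrightarrow> y \<in> M" if "x \<in> M" "y \<in> carrier V" for x y
      using that by (metis M.m_closed M.mem_carrier m_self_left)
    have "u \<otimes> v \<in> M" if "u \<notin> M" "v \<notin> M"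
    proof -
      have "(a \<otimes> u) \<otimes> (a \<otimes> v) = a \<otimes> (a \<otimes> (u \<otimes> v))"
        using uv a by (simp add: m_ac)
      also have "\<dots> = u \<otimes> v" using uv a by (simp add: m_self_left)
      finally show ?thesis using M.m_closed[OF coset[OF uv(1) that(1)] coset[OF uv(2) that(2)]] by simp
    qed
    moreover have "u \<otimes> v \<in> M \<longleftrightarrow> u \<in> M" if "v \<in> M"
      using in_iff[OF that uv(1)] uv by (simp add: m_comm)
    ultimately show "?l (u \<otimes> v) = ?l u + ?l v"
      using in_iff[of u v] uv by auto
  qed
  then show ?thesis
    by (rule that[of ?l]) (use M in \<open>auto simp: subset_iff\<close>)
qed

text \<open>Take a largest subgroup U on which Q agrees with some quadratic form q. If a vector a
  lies outside U, then q can be corrected so that it also agrees with Q on the coset of a,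
  contradicting the choice of U.\<close>

lemma quadratic_form_exists:
  assumes fin: "finite (carrier V)" and Q1: "Q \<one> = 0"
    and Q3: "\<And>u v w. \<lbrakk>u \<in> carrier V; v \<in> carrier V; w \<in> carrier V\<rbrakk> \<Longrightarrow> derived_form V Q [u, v, w] = 0"
  obtains q where "quadratic_form V q" "\<And>v. v \<in> carrier V \<Longrightarrow> Q v = q v"
proof -
  let ?P = "\<lambda>U. subgroup U V \<and> (\<exists>q. quadratic_form V q \<and> (\<forall>v\<in>U. Q v = q v))"
  have "?P {\<one>}"
    using Q1 quadratic_form.zero[of V] by (auto intro!: subgroup_of_closed)
  then have "\<exists>U. ?P U \<and> (\<forall>N. ?P N \<longrightarrow> card N \<le> card U)"
    by (rule ex_has_greatest_nat[where b = "Suc (card (carrier V))"])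
      (auto simp: less_Suc_eq_le intro!: card_mono fin dest: subgroup.subset)
  then obtain U q where U: "subgroup U V" and q: "quadratic_form V q" "\<forall>v\<in>U. Q v = q v"
    and max: "\<And>N. ?P N \<Longrightarrow> card N \<le> card U"
    by blast
  interpret U: subgroup U V by (rule U)
  have "carrier V \<subseteq> U"
  proof
    fix a assume a: "a \<in> carrier V"
    show "a \<in> U"
    proof (rule ccontr)
      assume aU: "a \<notin> U"
      obtain l where l: "linear_form V l" "\<And>u. u \<in> U \<Longrightarrow> l u = 0" "l a = 1"
        using ex_separating_linear_form[OF fin U a aU] by blast
      define T where "T v = Q v + q v" for v
      have T1: "T \<one> = 0" using q U.one_closed by (simp add: T_def)
      have T3: "derived_form V T [u, v, w] = 0"
        if "u \<in> carrier V" "v \<in> carrier V" "w \<in> carrier V" for u v w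
      proof -
        have "derived_form V T [u, v, w] = derived_form V Q [u, v, w] + derived_form V q [u, v, w]"
          using that by (simp add: derived_form3 T_def ac_simps)
        then show ?thesis
          using that Q3 quadratic_form_derived[OF q(1)] by simp
      qed
      \<comment> \<open>This is the polar form of the error T at a. It is linear because the third
        derived form of T vanishes.\<close>
      define k where "k v = T a + T v + T (a \<otimes> v)" for v
      have k: "linear_form V k"
        unfolding linear_form_def
      proof (intro ballI)
        fix u v assume uv: "u \<in> carrier V" "v \<in> carrier V"
        have "derived_form V T [a, u, v] = k u + k v + k (u \<otimes> v)"
          using uv a by (simp add: derived_form3 k_def ac_simps m_assoc)
        then have "k u + k v + k (u \<otimes> v) = 0"
          using uv a T3 by simp
        then show "k (u \<otimes> v) = k u + k v" by simp
      qed
      \<comment> \<open>The correction vanishes on U, where l does. On v = au with u in U, l(v) = 1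
        and k(v) = T(a) + T(v) because T(u) = 0, so l(v)k(v) + T(a)l(v) = T(v). The linear term is
        squared to have the shape required by \<open>quadratic_form.add\<close>.\<close>
      define q' where "q' v = (q v + l v * k v) + (T a * l v) * (T a * l v)" for v
      have "linear_form V (\<lambda>v. T a * l v)"
        using l(1) by (simp add: linear_form_def algebra_simps)
      then have q': "quadratic_form V q'"
        unfolding q'_def using q l k by (intro quadratic_form.add)
      have "Q v = q' v" if "v \<in> U \<union> (\<lambda>u. a \<otimes> u) ` U" for v
        using that
      proof
        assume "v \<in> U"
        then show ?thesis using q l by (simp add: q'_def)
      next
        assume "v \<in> (\<lambda>u. a \<otimes> u) ` U"
        then obtain u where u: "u \<in> U" "v = a \<otimes> u" by blast
        have "T u = 0" using u q by (simp add: T_def)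
        then have "k v = T a + T v"
          using u a by (simp add: k_def m_self_left)
        moreover have "l v = 1"
          using l u a by (simp add: linear_form_def)
        ultimately show ?thesis
          by (simp add: q'_def T_def ac_simps)
      qed
      then have "card (U \<union> (\<lambda>u. a \<otimes> u) ` U) \<le> card U"
        using q' subgroup_extend[OF U a] max by blast
      moreover have "card U < card (U \<union> (\<lambda>u. a \<otimes> u) ` U)"
      proof (rule psubset_card_mono)
        show "finite (U \<union> (\<lambda>u. a \<otimes> u) ` U)" using U.subset fin by (simp add: finite_subset)
        have "a = a \<otimes> \<one>" using a by simp
        then show "U \<subset> U \<union> (\<lambda>u. a \<otimes> u) ` U" using U.one_closed aU by blast
      qed
      ultimately show False by simp
    qed
  qed
  then show ?thesis using q that by blast
qed

text \<open>The cocycle defines a central extension E of V by GF(2). Symmetry makes E abelian and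
  the zero diagonal gives it exponent two, so E is again a vector space. A linear form on E with
  value 1 at the generator of the kernel splits the extension, and its restriction to the section
  (u, 0) is the required c.\<close>

lemma symmetric_cocycle_is_coboundary:
  assumes fin: "finite (carrier V)"
    and norm: "\<And>u. u \<in> carrier V \<Longrightarrow> d \<one> u = 0"
    and diag: "\<And>u. u \<in> carrier V \<Longrightarrow> d u u = (0::bit)"
    and sym: "\<And>u v. \<lbrakk>u \<in> carrier V; v \<in> carrier V\<rbrakk> \<Longrightarrow> d u v = d v u"
    and cocycle: "\<And>u v w. \<lbrakk>u \<in> carrier V; v \<in> carrier V; w \<in> carrier V\<rbrakk>
      \<Longrightarrow> d u v + d (u \<otimes> v) w = d v w + d u (v \<otimes> w)"
  obtains c where "\<And>u v. \<lbrakk>u \<in> carrier V; v \<in> carrier V\<rbrakk> \<Longrightarrow> d u v = c u + c v + c (u \<otimes> v)"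
proof -
  define E where "E = \<lparr>carrier = carrier V \<times> (UNIV :: bit set),
    mult = \<lambda>x y. (fst x \<otimes> fst y, snd x + snd y + d (fst x) (fst y)), one = (\<one>, 0)\<rparr>"
  have "comm_group E"
  proof (rule comm_groupI)
    fix x y w assume xyw: "x \<in> carrier E" "y \<in> carrier E" "w \<in> carrier E"
    obtain u a v b t c where uvw: "x = (u, a)" "y = (v, b)" "w = (t, c)"
      "u \<in> carrier V" "v \<in> carrier V" "t \<in> carrier V"
      using xyw by (auto simp: E_def)
    show "x \<otimes>\<^bsub>E\<^esub> y \<otimes>\<^bsub>E\<^esub> w = x \<otimes>\<^bsub>E\<^esub> (y \<otimes>\<^bsub>E\<^esub> w)"
      using cocycle[of u v t] uvw by (simp add: E_def m_assoc ac_simps)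
  next
    fix x assume "x \<in> carrier E"
    then show "\<exists>y\<in>carrier E. y \<otimes>\<^bsub>E\<^esub> x = \<one>\<^bsub>E\<^esub>"
      by (intro bexI[of _ x]) (auto simp: E_def m_self diag)
  qed (auto simp: E_def m_comm norm ac_simps intro: sym)
  then interpret E: elem_ab2 E
    by (intro elem_ab2.intro elem_ab2_axioms.intro) (auto simp: E_def m_self diag)
  have "finite (UNIV :: bit set)"
    by (rule finite_subset[of _ "{0, 1}"]) (auto intro: bit_not_zero_iff[THEN iffD1])
  then have "finite (carrier E)" using fin by (simp add: E_def)
  moreover have "subgroup {\<one>\<^bsub>E\<^esub>} E" by (rule E.subgroup_of_closed) auto
  moreover have "(\<one>, 1) \<in> carrier E" "(\<one>, 1) \<notin> {\<one>\<^bsub>E\<^esub>}" by (auto simp: E_def)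
  ultimately obtain l where l: "linear_form E l" "l (\<one>, 1) = 1"
    using E.ex_separating_linear_form by metis
  have l_mult: "l (u \<otimes> v, a + b + d u v) = l (u, a) + l (v, b)"
    if "u \<in> carrier V" "v \<in> carrier V" for u v a b
    using l(1) that unfolding linear_form_def E_def by fastforce
  have l_snd: "l (u, a) = l (u, 0) + a" if "u \<in> carrier V" for u a
    using l_mult[of \<one> u 1 0] l(2) that norm by (cases a) (simp_all add: ac_simps)
  show ?thesis
  proof (rule that[of "\<lambda>u. l (u, 0)"])
    fix u v assume "u \<in> carrier V" "v \<in> carrier V"
    then show "d u v = l (u, 0) + l (v, 0) + l (u \<otimes> v, 0)"
      using l_mult[of u v 0 0] l_snd[of "u \<otimes> v" "d u v"]
      by (metis add.commute add_0 bit_add_self_left m_closed)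
  qed
qed

end

section \<open>Symplectic loops and code loops elementwise\<close>

context loop
begin

lemma left_cancel:
  "\<lbrakk>a \<in> carrier G; x \<in> carrier G; y \<in> carrier G; a \<otimes> x = a \<otimes> y\<rbrakk> \<Longrightarrow> x = y"
  using loop_left_division[of a "a \<otimes> y"] by (metis loop_m_closed)

lemma right_cancel:
  "\<lbrakk>a \<in> carrier G; x \<in> carrier G; y \<in> carrier G; x \<otimes> a = y \<otimes> a\<rbrakk> \<Longrightarrow> x = y"
  using loop_right_division[of a "y \<otimes> a"] by (metis loop_m_closed)

lemma loop_commutator_eqI:
  assumes "x \<in> carrier G" "y \<in> carrier G" "w \<in> carrier G" "x \<otimes> y = (y \<otimes> x) \<otimes> w"
  shows "loop_commutator G x y = w"
  unfolding loop_commutator_def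
proof (rule the_equality)
  show "w' = w" if "w' \<in> carrier G \<and> x \<otimes> y = (y \<otimes> x) \<otimes> w'" for w'
    using that assms left_cancel[of "y \<otimes> x" w' w] by (simp add: loop_m_closed)
qed (use assms in simp)

lemma loop_commutator:
  assumes "x \<in> carrier G" "y \<in> carrier G"
  shows "loop_commutator G x y \<in> carrier G"
    and "x \<otimes> y = (y \<otimes> x) \<otimes> loop_commutator G x y"
proof -
  obtain w where "w \<in> carrier G" "(y \<otimes> x) \<otimes> w = x \<otimes> y"
    using loop_left_division[of "y \<otimes> x" "x \<otimes> y"] assms loop_m_closed by blast
  then show "loop_commutator G x y \<in> carrier G"
    and "x \<otimes> y = (y \<otimes> x) \<otimes> loop_commutator G x y"
    using loop_commutator_eqI[of x y w] assms by simp_all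
qed

lemma loop_associator_eqI:
  assumes "x \<in> carrier G" "y \<in> carrier G" "u \<in> carrier G" "w \<in> carrier G"
    and "(x \<otimes> y) \<otimes> u = (x \<otimes> (y \<otimes> u)) \<otimes> w"
  shows "loop_associator G x y u = w"
  unfolding loop_associator_def
proof (rule the_equality)
  show "w' = w" if "w' \<in> carrier G \<and> (x \<otimes> y) \<otimes> u = (x \<otimes> (y \<otimes> u)) \<otimes> w'" for w'
    using that assms left_cancel[of "x \<otimes> (y \<otimes> u)" w' w] by (simp add: loop_m_closed)
qed (use assms in simp)

lemma loop_associator:
  assumes "x \<in> carrier G" "y \<in> carrier G" "u \<in> carrier G"
  shows "loop_associator G x y u \<in> carrier G"
    and "(x \<otimes> y) \<otimes> u = (x \<otimes> (y \<otimes> u)) \<otimes> loop_associator G x y u"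
proof -
  obtain w where "w \<in> carrier G" "(x \<otimes> (y \<otimes> u)) \<otimes> w = (x \<otimes> y) \<otimes> u"
    using loop_left_division[of "x \<otimes> (y \<otimes> u)" "(x \<otimes> y) \<otimes> u"] assms loop_m_closed by blast
  then show "loop_associator G x y u \<in> carrier G"
    and "(x \<otimes> y) \<otimes> u = (x \<otimes> (y \<otimes> u)) \<otimes> loop_associator G x y u"
    using loop_associator_eqI[of x y u w] assms by simp_all
qed

lemma loop_commutator_eq_one_iff:
  assumes "x \<in> carrier G" "y \<in> carrier G"
  shows "loop_commutator G x y = \<one> \<longleftrightarrow> x \<otimes> y = y \<otimes> x"
  using loop_commutator(2)[OF assms] loop_commutator_eqI[of x y \<one>] assms
  by (metis loop_m_closed loop_one_closed loop_r_one)

lemma loop_associator_eq_one_iff: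
  assumes "x \<in> carrier G" "y \<in> carrier G" "u \<in> carrier G"
  shows "loop_associator G x y u = \<one> \<longleftrightarrow> (x \<otimes> y) \<otimes> u = x \<otimes> (y \<otimes> u)"
  using loop_associator(2)[OF assms] loop_associator_eqI[of x y u \<one>] assms
  by (metis loop_m_closed loop_one_closed loop_r_one)

end

text \<open>On a finite set, injective translations are bijective, so cancellation already gives
  both divisions.\<close>

lemma finite_loopI:
  fixes G (structure)
  assumes fin: "finite (carrier G)"
    and closed: "\<And>x y. \<lbrakk>x \<in> carrier G; y \<in> carrier G\<rbrakk> \<Longrightarrow> x \<otimes> y \<in> carrier G"
    and one: "\<one> \<in> carrier G"
    and l_one: "\<And>x. x \<in> carrier G \<Longrightarrow> \<one> \<otimes> x = x"
    and r_one: "\<And>x. x \<in> carrier G \<Longrightarrow> x \<otimes> \<one> = x"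
    and left: "\<And>a x y. \<lbrakk>a \<in> carrier G; x \<in> carrier G; y \<in> carrier G; a \<otimes> x = a \<otimes> y\<rbrakk> \<Longrightarrow> x = y"
    and right: "\<And>a x y. \<lbrakk>a \<in> carrier G; x \<in> carrier G; y \<in> carrier G; x \<otimes> a = y \<otimes> a\<rbrakk> \<Longrightarrow> x = y"
  shows "loop G"
proof
  fix a b assume ab: "a \<in> carrier G" "b \<in> carrier G"
  have "(\<lambda>x. a \<otimes> x) ` carrier G = carrier G"
    using left[OF ab(1)] closed[OF ab(1)] by (intro endo_inj_surj fin) (auto simp: inj_on_def)
  then obtain x where "x \<in> carrier G" "a \<otimes> x = b"
    using ab(2) by (metis imageE)
  then show "\<exists>!x. x \<in> carrier G \<and> a \<otimes> x = b"
    using left[OF ab(1)] by (intro ex1I[of _ x]) simp_all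
  have "(\<lambda>x. x \<otimes> a) ` carrier G = carrier G"
    using right[OF ab(1)] closed[OF _ ab(1)] by (intro endo_inj_surj fin) (auto simp: inj_on_def)
  then obtain y where "y \<in> carrier G" "y \<otimes> a = b"
    using ab(2) by (metis imageE)
  then show "\<exists>!y. y \<in> carrier G \<and> y \<otimes> a = b"
    using right[OF ab(1)] by (intro ex1I[of _ y]) simp_all
qed (simp_all add: closed one l_one r_one)

text \<open>An element-level form of \<open>symplectic_loop\<close> with Z = {1, z}: the properties
  of the quotient become the statements that squares, commutators and associators are 1 or z. The
  lemmas \<open>symplectic_loop\<close> and \<open>symplectic_loopE\<close> translate between the
  two forms.\<close>

locale symplectic = loop +
  fixes z
  assumes fin: "finite (carrier G)"
    and z_closed: "z \<in> carrier G"
    and z_ne_one: "z \<noteq> \<one>"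
    and z_z: "z \<otimes> z = \<one>"
    and z_comm: "x \<in> carrier G \<Longrightarrow> z \<otimes> x = x \<otimes> z"
    and z_right: "\<lbrakk>x \<in> carrier G; y \<in> carrier G\<rbrakk> \<Longrightarrow> x \<otimes> (y \<otimes> z) = (x \<otimes> y) \<otimes> z"
    and z_mid: "\<lbrakk>x \<in> carrier G; y \<in> carrier G\<rbrakk> \<Longrightarrow> (x \<otimes> z) \<otimes> y = (x \<otimes> y) \<otimes> z"
    and square_mem: "x \<in> carrier G \<Longrightarrow> x \<otimes> x = \<one> \<or> x \<otimes> x = z"
    and commutes_mod: "\<lbrakk>x \<in> carrier G; y \<in> carrier G\<rbrakk>
      \<Longrightarrow> x \<otimes> y = y \<otimes> x \<or> x \<otimes> y = (y \<otimes> x) \<otimes> z"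
    and associates_mod: "\<lbrakk>x \<in> carrier G; y \<in> carrier G; w \<in> carrier G\<rbrakk>
      \<Longrightarrow> (x \<otimes> y) \<otimes> w = x \<otimes> (y \<otimes> w) \<or> (x \<otimes> y) \<otimes> w = (x \<otimes> (y \<otimes> w)) \<otimes> z"
begin

declare loop_m_closed [simp] loop_one_closed [simp] loop_l_one [simp] loop_r_one [simp]
  z_closed [simp] z_ne_one [simp]

text \<open>The action of GF(2) on the loop by powers of z. It commutes with both translations, so
  computations in the loop reduce to additions of bits.\<close>

definition shift :: "'a \<Rightarrow> bit \<Rightarrow> 'a" where
  "shift x b = (if b = 0 then x else x \<otimes> z)"

abbreviation Z :: "'a set" where
  "Z \<equiv> {\<one>, z}"

definition cl :: "'a \<Rightarrow> 'a set" where
  "cl x = {x, x \<otimes> z}"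

abbreviation V :: "'a set monoid" where
  "V \<equiv> G Mod Z"

definition sq :: "'a \<Rightarrow> bit" where
  "sq x = to_gf2 G (x \<otimes> x)"

definition cm :: "'a \<Rightarrow> 'a \<Rightarrow> bit" where
  "cm x y = to_gf2 G (loop_commutator G x y)"

definition as :: "'a \<Rightarrow> 'a \<Rightarrow> 'a \<Rightarrow> bit" where
  "as x y w = to_gf2 G (loop_associator G x y w)"

lemma shift_closed [simp]: "x \<in> carrier G \<Longrightarrow> shift x b \<in> carrier G"
  by (simp add: shift_def)

lemma shift_0 [simp]: "shift x 0 = x"
  by (simp add: shift_def)

lemma z_z_right: "x \<in> carrier G \<Longrightarrow> (x \<otimes> z) \<otimes> z = x"
  using z_right[of x z] by (simp add: z_z)

lemma shift_shift [simp]: "x \<in> carrier G \<Longrightarrow> shift (shift x a) b = shift x (a + b)"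
  by (cases a; cases b) (simp_all add: shift_def z_z_right)

lemma shift_mult [simp]:
  "\<lbrakk>x \<in> carrier G; y \<in> carrier G\<rbrakk> \<Longrightarrow> shift x a \<otimes> y = shift (x \<otimes> y) a"
  by (simp add: shift_def z_mid)

lemma mult_shift [simp]:
  "\<lbrakk>x \<in> carrier G; y \<in> carrier G\<rbrakk> \<Longrightarrow> x \<otimes> shift y a = shift (x \<otimes> y) a"
  by (simp add: shift_def z_right)

lemma z_ne: "x \<in> carrier G \<Longrightarrow> x \<otimes> z \<noteq> x"
  using left_cancel[of x z \<one>] by auto

lemma shift_eq_shift_iff [simp]: "x \<in> carrier G \<Longrightarrow> shift x a = shift x b \<longleftrightarrow> a = b"
  using z_ne[of x] by (cases a; cases b) (auto simp: shift_def dest: sym)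

lemma shift_one_1: "shift \<one> 1 = z"
  by (simp add: shift_def)

lemma mem_cl_iff: "y \<in> cl x \<longleftrightarrow> (\<exists>a. y = shift x a)"
proof
  assume "y \<in> cl x"
  then have "y = shift x 0 \<or> y = shift x 1" by (auto simp: cl_def shift_def)
  then show "\<exists>a. y = shift x a" by blast
qed (auto simp: cl_def shift_def)

lemma cl_shift [simp]: "x \<in> carrier G \<Longrightarrow> cl (shift x a) = cl x"
  by (cases a) (auto simp: cl_def shift_def z_z_right)

lemma self_mem_cl [simp]: "x \<in> cl x"
  by (simp add: cl_def)

lemma cl_nonempty [simp]: "cl x \<noteq> {}"
  by (simp add: cl_def)

lemma cl_eq_iff: "x \<in> carrier G \<Longrightarrow> cl x = cl y \<longleftrightarrow> (\<exists>a. y = shift x a)"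
  using mem_cl_iff[of y x] cl_shift[of x] self_mem_cl[of y] by metis

lemma cl_one: "cl \<one> = Z"
  by (simp add: cl_def)

lemma coset_eq_cl: "x \<in> carrier G \<Longrightarrow> Z #> x = cl x"
  by (auto simp: r_coset_def cl_def z_comm)

lemma carrier_V: "carrier V = cl ` carrier G"
  by (auto simp: FactGroup_def RCOSETS_def coset_eq_cl)

lemma one_V [simp]: "\<one>\<^bsub>V\<^esub> = cl \<one>"
  by (simp add: cl_one)

lemma mult_V:
  assumes "x \<in> carrier G" "y \<in> carrier G"
  shows "cl x \<otimes>\<^bsub>V\<^esub> cl y = cl (x \<otimes> y)"
proof -
  have "(x \<otimes> z) \<otimes> (y \<otimes> z) = x \<otimes> y"
    using assms z_right[of "x \<otimes> z" y] z_mid[of x y] z_z_right by simp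
  then show ?thesis
    using assms z_right[of x y] z_mid[of x y] by (simp add: set_mult_def cl_def insert_commute)
qed

lemma cl_carrier_V [simp]: "x \<in> carrier G \<Longrightarrow> cl x \<in> carrier V"
  by (simp add: carrier_V)

lemma carrier_V_E:
  assumes "v \<in> carrier V"
  obtains x where "x \<in> carrier G" "v = cl x"
  using assms by (auto simp: carrier_V)

lemma to_gf2_shift_one [simp]: "to_gf2 G (shift \<one> a) = a"
  by (cases a) (simp_all add: to_gf2_def shift_one_1)

lemma square_eq: "x \<in> carrier G \<Longrightarrow> x \<otimes> x = shift \<one> (sq x)"
  using square_mem[of x] by (auto simp: sq_def to_gf2_def shift_def)

lemma shift_exists:
  "x = y \<or> x = y \<otimes> z \<Longrightarrow> \<exists>a. x = shift y a"
  using mem_cl_iff[of x y] by (auto simp: cl_def)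

lemma cm_eqI:
  assumes "x \<in> carrier G" "y \<in> carrier G" "x \<otimes> y = shift (y \<otimes> x) a"
  shows "cm x y = a"
proof -
  have "loop_commutator G x y = shift \<one> a"
    using assms by (intro loop_commutator_eqI) simp_all
  then show ?thesis by (simp add: cm_def)
qed

lemma commute: "\<lbrakk>x \<in> carrier G; y \<in> carrier G\<rbrakk> \<Longrightarrow> x \<otimes> y = shift (y \<otimes> x) (cm x y)"
  using shift_exists[OF commutes_mod] cm_eqI by metis

lemma as_eqI:
  assumes "x \<in> carrier G" "y \<in> carrier G" "w \<in> carrier G"
    and "(x \<otimes> y) \<otimes> w = shift (x \<otimes> (y \<otimes> w)) a"
  shows "as x y w = a"
proof -
  have "loop_associator G x y w = shift \<one> a"
    using assms by (intro loop_associator_eqI) simp_all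
  then show ?thesis by (simp add: as_def)
qed

lemma associate: "\<lbrakk>x \<in> carrier G; y \<in> carrier G; w \<in> carrier G\<rbrakk>
  \<Longrightarrow> (x \<otimes> y) \<otimes> w = shift (x \<otimes> (y \<otimes> w)) (as x y w)"
  using shift_exists[OF associates_mod] as_eqI by metis

lemma sq_shift: "x \<in> carrier G \<Longrightarrow> sq (shift x a) = sq x"
  by (simp add: sq_def)

lemma cm_shift:
  assumes "x \<in> carrier G" "y \<in> carrier G"
  shows "cm (shift x a) (shift y b) = cm x y"
  using assms commute[OF assms] by (intro cm_eqI) (simp_all add: ac_simps)

lemma as_shift:
  assumes "x \<in> carrier G" "y \<in> carrier G" "w \<in> carrier G"
  shows "as (shift x a) (shift y b) (shift w c) = as x y w"
  using assms associate[OF assms] by (intro as_eqI) (simp_all add: ac_simps)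

lemma power_map_cl: "x \<in> carrier G \<Longrightarrow> power_map G (cl x) = sq x"
  unfolding power_map_def sq_def[symmetric]
  by (rule the_elem_image_unique) (auto simp: mem_cl_iff sq_shift)

lemma commutator_map_cl:
  assumes "x \<in> carrier G" "y \<in> carrier G"
  shows "commutator_map G (cl x) (cl y) = cm x y"
proof -
  have "the_elem ((\<lambda>(a, b). cm a b) ` (cl x \<times> cl y)) = (\<lambda>(a, b). cm a b) (x, y)"
    using assms by (intro the_elem_image_unique) (auto simp: mem_cl_iff cm_shift)
  then show ?thesis by (simp add: commutator_map_def cm_def)
qed

lemma associator_map_cl:
  assumes "x \<in> carrier G" "y \<in> carrier G" "w \<in> carrier G"
  shows "associator_map G (cl x) (cl y) (cl w) = as x y w"
proof -
  have "the_elem ((\<lambda>(a, b, c). as a b c) ` (cl x \<times> cl y \<times> cl w)) = (\<lambda>(a, b, c). as a b c) (x, y, w)"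
    using assms by (intro the_elem_image_unique) (auto simp: mem_cl_iff as_shift)
  then show ?thesis by (simp add: associator_map_def as_def)
qed

lemma finite_V: "finite (carrier V)"
  by (simp add: carrier_V fin)

lemma cl_square: "x \<in> carrier G \<Longrightarrow> cl (x \<otimes> x) = cl \<one>"
  by (simp add: square_eq)

lemma cl_commute: "\<lbrakk>x \<in> carrier G; y \<in> carrier G\<rbrakk> \<Longrightarrow> cl (x \<otimes> y) = cl (y \<otimes> x)"
  by (simp add: commute[of x y])

lemma cl_assoc:
  "\<lbrakk>x \<in> carrier G; y \<in> carrier G; w \<in> carrier G\<rbrakk> \<Longrightarrow> cl (x \<otimes> y \<otimes> w) = cl (x \<otimes> (y \<otimes> w))"
  by (simp add: associate)

sublocale V: elem_ab2 V
proof (intro elem_ab2.intro elem_ab2_axioms.intro comm_groupI)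
  fix u v assume "u \<in> carrier V" "v \<in> carrier V"
  then show "u \<otimes>\<^bsub>V\<^esub> v \<in> carrier V" "u \<otimes>\<^bsub>V\<^esub> v = v \<otimes>\<^bsub>V\<^esub> u"
    unfolding carrier_V by (auto simp: mult_V cl_commute simp del: mult_FactGroup)
next
  fix u v w assume "u \<in> carrier V" "v \<in> carrier V" "w \<in> carrier V"
  then show "u \<otimes>\<^bsub>V\<^esub> v \<otimes>\<^bsub>V\<^esub> w = u \<otimes>\<^bsub>V\<^esub> (v \<otimes>\<^bsub>V\<^esub> w)"
    unfolding carrier_V by (auto simp: mult_V cl_assoc simp del: mult_FactGroup)
next
  show "\<one>\<^bsub>V\<^esub> \<in> carrier V" unfolding one_V by simp
next
  fix v assume v: "v \<in> carrier V"
  then show "\<one>\<^bsub>V\<^esub> \<otimes>\<^bsub>V\<^esub> v = v"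
    unfolding carrier_V one_V by (auto simp: mult_V simp del: mult_FactGroup)
  show "v \<otimes>\<^bsub>V\<^esub> v = \<one>\<^bsub>V\<^esub>"
    using v unfolding carrier_V one_V by (auto simp: mult_V cl_square simp del: mult_FactGroup)
  then show "\<exists>u\<in>carrier V. u \<otimes>\<^bsub>V\<^esub> v = \<one>\<^bsub>V\<^esub>" using v by blast
qed

declare mult_FactGroup [simp del] one_FactGroup [simp del]

lemma power_map_one: "power_map G \<one>\<^bsub>V\<^esub> = 0"
  unfolding one_V by (simp add: power_map_cl sq_def to_gf2_def)

lemma symplectic_loop: "symplectic_loop G Z"
proof -
  have "loop (G\<lparr>carrier := Z\<rparr>)"
    by (rule finite_loopI) (auto simp: z_z)
  moreover have "Z \<subseteq> loop_center G"
    by (auto simp: loop_center_def loop_commutator_eq_one_iff loop_associator_eq_one_iff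
        z_comm z_mid)
  moreover have "loop_associator G x w y = \<one> \<and> loop_associator G x y w = \<one>"
    if "w \<in> Z" "x \<in> carrier G" "y \<in> carrier G" for w x y
    using that by (auto simp: loop_associator_eq_one_iff z_comm z_mid z_right)
  moreover have "card Z = 2"
    using z_ne_one[symmetric] by simp
  ultimately show ?thesis
    using loop_axioms fin V.elem_ab2_axioms
    by (simp add: symplectic_loop_def central_subloop_def subloop_def elem_ab2_iff)
qed

end

text \<open>The identities of the elementary abelian quotient are equalities of cosets, which are
  pairs x, xz; comparing members of two such pairs gives the alternatives up to a factor z.\<close>

lemma symplectic_loopE:
  assumes "symplectic_loop G Z"
  obtains z where "Z = {\<one>\<^bsub>G\<^esub>, z}" "symplectic G z"
proof -
  interpret loop G using assms by (simp add: symplectic_loop_def)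
  interpret V: elem_ab2 "G Mod Z" using assms by (simp add: symplectic_loop_def elem_ab2_iff)
  note [simp] = loop_m_closed loop_one_closed loop_l_one loop_r_one
  have ZG: "Z \<subseteq> carrier G" and central: "Z \<subseteq> loop_center G"
    and assoc: "\<And>z x y. \<lbrakk>z \<in> Z; x \<in> carrier G; y \<in> carrier G\<rbrakk>
      \<Longrightarrow> loop_associator G x z y = \<one>\<^bsub>G\<^esub> \<and> loop_associator G x y z = \<one>\<^bsub>G\<^esub>"
    and fin: "finite (carrier G)"
    using assms by (auto simp: symplectic_loop_def central_subloop_def subloop_def)
  interpret Z: loop "G\<lparr>carrier := Z\<rparr>"
    using assms by (simp add: symplectic_loop_def central_subloop_def subloop_def)
  have "\<one>\<^bsub>G\<^esub> \<in> Z" using Z.loop_one_closed by simp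
  moreover have "card Z = 2" using assms by (simp add: symplectic_loop_def)
  ultimately obtain z where z: "Z = {\<one>\<^bsub>G\<^esub>, z}" "z \<noteq> \<one>\<^bsub>G\<^esub>"
    by (metis card_2_iff insert_commute insertE singletonD)
  have zG: "z \<in> carrier G" using ZG z by simp
  have comm: "z \<otimes>\<^bsub>G\<^esub> x = x \<otimes>\<^bsub>G\<^esub> z" if "x \<in> carrier G" for x
    using that central z(1) zG
    by (auto simp: loop_center_def loop_commutator_eq_one_iff subset_iff)
  have right: "x \<otimes>\<^bsub>G\<^esub> (y \<otimes>\<^bsub>G\<^esub> z) = x \<otimes>\<^bsub>G\<^esub> y \<otimes>\<^bsub>G\<^esub> z"
    and mid: "x \<otimes>\<^bsub>G\<^esub> z \<otimes>\<^bsub>G\<^esub> y = x \<otimes>\<^bsub>G\<^esub> y \<otimes>\<^bsub>G\<^esub> z"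
    if "x \<in> carrier G" "y \<in> carrier G" for x y
    using that assoc[of z x y] zG z(1) comm[of y] by (auto simp: loop_associator_eq_one_iff)
  have coset: "Z #>\<^bsub>G\<^esub> x = {x, x \<otimes>\<^bsub>G\<^esub> z}" if "x \<in> carrier G" for x
    using that comm by (auto simp: r_coset_def z(1))
  have mem: "{x, x \<otimes>\<^bsub>G\<^esub> z} \<in> carrier (G Mod Z)" if "x \<in> carrier G" for x
    using that coset by (auto simp: FactGroup_def RCOSETS_def)
  have "z \<otimes>\<^bsub>G\<^esub> z \<in> Z" using Z.loop_m_closed[of z z] z(1) by simp
  moreover have "z \<otimes>\<^bsub>G\<^esub> z \<noteq> z" using left_cancel[of z z "\<one>\<^bsub>G\<^esub>"] zG z(2) by auto
  ultimately have zz: "z \<otimes>\<^bsub>G\<^esub> z = \<one>\<^bsub>G\<^esub>" using z(1) by simp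
  then have zzr: "x \<otimes>\<^bsub>G\<^esub> z \<otimes>\<^bsub>G\<^esub> z = x" if "x \<in> carrier G" for x
    using that right[of x z] zG by simp
  have mult: "{x, x \<otimes>\<^bsub>G\<^esub> z} \<otimes>\<^bsub>G Mod Z\<^esub> {y, y \<otimes>\<^bsub>G\<^esub> z} = {x \<otimes>\<^bsub>G\<^esub> y, x \<otimes>\<^bsub>G\<^esub> y \<otimes>\<^bsub>G\<^esub> z}"
    if "x \<in> carrier G" "y \<in> carrier G" for x y
  proof -
    have "(x \<otimes>\<^bsub>G\<^esub> z) \<otimes>\<^bsub>G\<^esub> (y \<otimes>\<^bsub>G\<^esub> z) = x \<otimes>\<^bsub>G\<^esub> y"
      using that zG right[of "x \<otimes>\<^bsub>G\<^esub> z" y] mid[of x y] zzr by simp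
    then show ?thesis
      using that right[of x y] mid[of x y] by (simp add: set_mult_def insert_commute)
  qed
  show ?thesis
  proof (rule that[OF z(1)], intro symplectic.intro symplectic_axioms.intro)
    fix x y w assume xyw: "x \<in> carrier G" "y \<in> carrier G" "w \<in> carrier G"
    show "x \<otimes>\<^bsub>G\<^esub> x = \<one>\<^bsub>G\<^esub> \<or> x \<otimes>\<^bsub>G\<^esub> x = z"
    proof -
      have "{x \<otimes>\<^bsub>G\<^esub> x, x \<otimes>\<^bsub>G\<^esub> x \<otimes>\<^bsub>G\<^esub> z} = {\<one>\<^bsub>G\<^esub>, z}"
        using V.m_self[OF mem[OF xyw(1)]] mult[of x x] xyw(1) z(1) by simp
      then show ?thesis by blast
    qed
    show "x \<otimes>\<^bsub>G\<^esub> y = y \<otimes>\<^bsub>G\<^esub> x \<or> x \<otimes>\<^bsub>G\<^esub> y = y \<otimes>\<^bsub>G\<^esub> x \<otimes>\<^bsub>G\<^esub> z"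
    proof -
      have "{x \<otimes>\<^bsub>G\<^esub> y, x \<otimes>\<^bsub>G\<^esub> y \<otimes>\<^bsub>G\<^esub> z} = {y \<otimes>\<^bsub>G\<^esub> x, y \<otimes>\<^bsub>G\<^esub> x \<otimes>\<^bsub>G\<^esub> z}"
        using V.m_comm[OF mem[OF xyw(1)] mem[OF xyw(2)]]
        unfolding mult[OF xyw(1,2)] mult[OF xyw(2,1)] .
      then show ?thesis by blast
    qed
    show "x \<otimes>\<^bsub>G\<^esub> y \<otimes>\<^bsub>G\<^esub> w = x \<otimes>\<^bsub>G\<^esub> (y \<otimes>\<^bsub>G\<^esub> w)
        \<or> x \<otimes>\<^bsub>G\<^esub> y \<otimes>\<^bsub>G\<^esub> w = x \<otimes>\<^bsub>G\<^esub> (y \<otimes>\<^bsub>G\<^esub> w) \<otimes>\<^bsub>G\<^esub> z"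
    proof -
      have xy: "x \<otimes>\<^bsub>G\<^esub> y \<in> carrier G" and yw: "y \<otimes>\<^bsub>G\<^esub> w \<in> carrier G" using xyw by simp_all
      have "{x \<otimes>\<^bsub>G\<^esub> y \<otimes>\<^bsub>G\<^esub> w, x \<otimes>\<^bsub>G\<^esub> y \<otimes>\<^bsub>G\<^esub> w \<otimes>\<^bsub>G\<^esub> z}
          = {x \<otimes>\<^bsub>G\<^esub> (y \<otimes>\<^bsub>G\<^esub> w), x \<otimes>\<^bsub>G\<^esub> (y \<otimes>\<^bsub>G\<^esub> w) \<otimes>\<^bsub>G\<^esub> z}"
        using V.m_assoc[OF mem[OF xyw(1)] mem[OF xyw(2)] mem[OF xyw(3)]]
        unfolding mult[OF xyw(1,2)] mult[OF xyw(2,3)] mult[OF xy xyw(3)] mult[OF xyw(1) yw] .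
      then show ?thesis by blast
    qed
  qed (simp_all add: loop_axioms fin zG z(2) zz comm right mid)
qed

text \<open>\<open>cm_eq\<close> is C = P_2 and \<open>as_eq\<close> is A = P_3. In the presence of
  the latter, \<open>as_add\<close> expresses that the power map has combinatorial degree at most
  three.\<close>

locale symplectic_code = symplectic +
  assumes cm_eq: "\<lbrakk>x \<in> carrier G; y \<in> carrier G\<rbrakk> \<Longrightarrow> cm x y = sq x + sq y + sq (x \<otimes> y)"
    and as_eq: "\<lbrakk>x \<in> carrier G; y \<in> carrier G; w \<in> carrier G\<rbrakk> \<Longrightarrow>
      as x y w = sq x + sq y + sq w + sq (x \<otimes> y) + sq (x \<otimes> w) + sq (y \<otimes> w) + sq (x \<otimes> y \<otimes> w)"
    and as_add: "\<lbrakk>x \<in> carrier G; x' \<in> carrier G; y \<in> carrier G; w \<in> carrier G\<rbrakk> \<Longrightarrow>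
      as (x \<otimes> x') y w = as x y w + as x' y w"

context symplectic
begin

lemma derived_power_map2:
  assumes "x \<in> carrier G" "y \<in> carrier G"
  shows "derived_form V (power_map G) [cl x, cl y] = sq x + sq y + sq (x \<otimes> y)"
  using assms by (simp add: V.derived_form2 mult_V power_map_cl)

lemma derived_power_map3:
  assumes "x \<in> carrier G" "y \<in> carrier G" "w \<in> carrier G"
  shows "derived_form V (power_map G) [cl x, cl y, cl w]
    = sq x + sq y + sq w + sq (x \<otimes> y) + sq (x \<otimes> w) + sq (y \<otimes> w) + sq (x \<otimes> y \<otimes> w)"
  using assms by (simp add: V.derived_form3 mult_V power_map_cl)

lemma code_loop_iff: "code_loop G Z \<longleftrightarrow> symplectic_code G z"
proof
  assume c: "code_loop G Z"
  have as_eq: "as x y w = derived_form V (power_map G) [cl x, cl y, cl w]"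
    if "x \<in> carrier G" "y \<in> carrier G" "w \<in> carrier G" for x y w
    using c that by (simp add: code_loop_def flip: associator_map_cl)
  show "symplectic_code G z"
  proof
    fix x y assume "x \<in> carrier G" "y \<in> carrier G"
    then show "cm x y = sq x + sq y + sq (x \<otimes> y)"
      using c by (simp add: code_loop_def flip: commutator_map_cl derived_power_map2)
  next
    fix x y w assume "x \<in> carrier G" "y \<in> carrier G" "w \<in> carrier G"
    then show "as x y w = sq x + sq y + sq w + sq (x \<otimes> y) + sq (x \<otimes> w) + sq (y \<otimes> w) + sq (x \<otimes> y \<otimes> w)"
      by (simp add: as_eq derived_power_map3)
  next
    fix x x' y w assume "x \<in> carrier G" "x' \<in> carrier G" "y \<in> carrier G" "w \<in> carrier G"
    then show "as (x \<otimes> x') y w = as x y w + as x' y w"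
      using c V.cdeg_le_3_iff[where f = "power_map G", OF finite_V power_map_one]
      by (simp add: as_eq code_loop_def flip: mult_V)
  qed
next
  assume "symplectic_code G z"
  then interpret symplectic_code G z .
  have as_eq': "as x y w = derived_form V (power_map G) [cl x, cl y, cl w]"
    if "x \<in> carrier G" "y \<in> carrier G" "w \<in> carrier G" for x y w
    using that by (simp add: as_eq derived_power_map3)
  have "cdeg V (power_map G) \<le> 3"
    unfolding V.cdeg_le_3_iff[where f = "power_map G", OF finite_V power_map_one]
    using as_add by (auto elim!: carrier_V_E simp: mult_V simp flip: as_eq')
  then show "code_loop G Z"
    using symplectic_loop
    by (auto elim!: carrier_V_E simp: code_loop_def commutator_map_cl associator_map_cl
        derived_power_map2 cm_eq as_eq')
qed

end

lemma code_loopE: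
  assumes "code_loop G Z"
  obtains z where "Z = {\<one>\<^bsub>G\<^esub>, z}" "symplectic_code G z"
  using assms symplectic_loopE[of G Z] symplectic.code_loop_iff[of G]
  by (metis code_loop_def)

section \<open>Code loops are Moufang loops\<close>

context symplectic_code
begin

lemma code_loop: "code_loop G Z"
  using code_loop_iff symplectic_code_axioms by simp

lemma sq_commute: "\<lbrakk>x \<in> carrier G; y \<in> carrier G\<rbrakk> \<Longrightarrow> sq (x \<otimes> y) = sq (y \<otimes> x)"
  by (metis commute loop_m_closed sq_shift)

text \<open>In \<open>as_eq\<close> the only term whose symmetry is not immediate is the triple
  product. Reordering it changes it by a power of z, which does not affect its square.\<close>

lemma as_swap12:
  assumes "x \<in> carrier G" "y \<in> carrier G" "w \<in> carrier G"
  shows "as x y w = as y x w"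
proof -
  have "sq (x \<otimes> y \<otimes> w) = sq (y \<otimes> x \<otimes> w)"
    unfolding commute[OF assms(1,2)] using assms by (simp add: sq_shift)
  then show ?thesis
    using assms sq_commute[of x y] by (simp add: as_eq ac_simps)
qed

lemma as_swap13:
  assumes "x \<in> carrier G" "y \<in> carrier G" "w \<in> carrier G"
  shows "as x y w = as w y x"
proof -
  have "sq (x \<otimes> y \<otimes> w) = sq (w \<otimes> (x \<otimes> y))"
    using assms by (simp add: sq_commute)
  also have "\<dots> = sq (w \<otimes> (y \<otimes> x))"
    unfolding commute[OF assms(1,2)] using assms by (simp add: sq_shift)
  also have "\<dots> = sq (w \<otimes> y \<otimes> x)"
    unfolding associate[OF assms(3,2,1)] using assms by (simp add: sq_shift)
  finally show ?thesis
    using assms sq_commute[of x y] sq_commute[of y w] sq_commute[of x w] by (simp add: as_eq ac_simps)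
qed

lemma as_self: "\<lbrakk>x \<in> carrier G; w \<in> carrier G\<rbrakk> \<Longrightarrow> as x x w = 0"
  by (simp add: as_eq square_eq sq_shift) (simp add: sq_def to_gf2_def)

text \<open>The associator is additive, symmetric, and zero when two arguments coincide. Passing
  from one side of the Moufang identity to the other costs the two associators [xy, x, w] and
  [x, y, xw]; both reduce to [x, y, w], so they cancel. The constructions require this, as they
  start from a Moufang loop.\<close>

lemma moufang: "moufang_loop G"
proof
  fix x y w assume xyw: "x \<in> carrier G" "y \<in> carrier G" "w \<in> carrier G"
  have "x \<otimes> y \<otimes> x \<otimes> w = shift (x \<otimes> y \<otimes> (x \<otimes> w)) (as (x \<otimes> y) x w)"
    using xyw by (intro associate) simp_all
  also have "x \<otimes> y \<otimes> (x \<otimes> w) = shift (x \<otimes> (y \<otimes> (x \<otimes> w))) (as x y (x \<otimes> w))"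
    using xyw by (intro associate) simp_all
  also have "as x y (x \<otimes> w) = as x y w"
  proof -
    have "as x y x = 0"
      using xyw as_swap12[of x y x] as_swap13[of y x x] as_self[of x y] by simp
    then show ?thesis
      using xyw as_swap13[of x y "x \<otimes> w"] as_swap13[of w y x] as_add[of x w y x] by simp
  qed
  also have "as (x \<otimes> y) x w = as x y w"
    using xyw as_add[of x y x w] as_self[of x w] as_swap12[of y x w] by simp
  finally show "x \<otimes> y \<otimes> x \<otimes> w = x \<otimes> (y \<otimes> (x \<otimes> w))" using xyw by simp
qed

end

section \<open>Twisting by a bilinear form\<close>

context symplectic
begin

lemma shift_cases: "shift x a = x \<or> shift x a = x \<otimes> z"
  by (simp add: shift_def)

lemma mult_z: "x \<otimes> z = shift x 1"
  by (simp add: shift_def)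

lemma cl_z: "cl z = cl \<one>"
  using cl_shift[of \<one> 1] by (simp add: shift_one_1)

end

definition bilinear_form :: "('v, 'c) monoid_scheme \<Rightarrow> ('v \<Rightarrow> 'v \<Rightarrow> bit) \<Rightarrow> bool" where
  "bilinear_form V g \<longleftrightarrow>
    (\<forall>v\<in>carrier V. linear_form V (\<lambda>u. g u v)) \<and> (\<forall>u\<in>carrier V. linear_form V (g u))"

text \<open>The common shape of both constructions once h = z and m = 1, with g a product of linear
  forms there. General bilinear g costs nothing more, as only additivity in each argument is
  used.\<close>

locale twist = symplectic_code G z for G :: "'a monoid" (structure) and z +
  fixes H :: "'a monoid" and g
  assumes carrier_H: "carrier H = carrier G" and one_H: "\<one>\<^bsub>H\<^esub> = \<one>"
    and bilinear: "bilinear_form V g"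
    and mult_H: "\<lbrakk>x \<in> carrier G; y \<in> carrier G\<rbrakk>
      \<Longrightarrow> x \<otimes>\<^bsub>H\<^esub> y = shift (x \<otimes> y) (g (cl x) (cl y))"
begin

definition b :: "'a \<Rightarrow> 'a \<Rightarrow> bit" where
  "b x y = g (cl x) (cl y)"

lemma b_mult_left:
  "\<lbrakk>x \<in> carrier G; y \<in> carrier G; w \<in> carrier G\<rbrakk> \<Longrightarrow> b (x \<otimes> y) w = b x w + b y w"
  using bilinear by (simp add: b_def bilinear_form_def linear_form_def flip: mult_V)

lemma b_mult_right:
  "\<lbrakk>x \<in> carrier G; y \<in> carrier G; w \<in> carrier G\<rbrakk> \<Longrightarrow> b w (x \<otimes> y) = b w x + b w y"
  using bilinear by (simp add: b_def bilinear_form_def linear_form_def flip: mult_V)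

lemma b_shift_left: "x \<in> carrier G \<Longrightarrow> b (shift x a) y = b x y"
  by (simp add: b_def)

lemma b_shift_right: "x \<in> carrier G \<Longrightarrow> b y (shift x a) = b y x"
  by (simp add: b_def)

lemma b_one: "x \<in> carrier G \<Longrightarrow> b \<one> x = 0" "x \<in> carrier G \<Longrightarrow> b x \<one> = 0"
  using b_mult_left[of \<one> \<one> x] b_mult_right[of \<one> \<one> x] bit_add_self by simp_all

lemma b_z: "x \<in> carrier G \<Longrightarrow> b z x = 0" "x \<in> carrier G \<Longrightarrow> b x z = 0"
  using b_one[of x] by (simp_all add: b_def cl_z)

lemmas b_simps = b_mult_left b_mult_right b_shift_left b_shift_right b_one b_z

lemma mult_H': "\<lbrakk>x \<in> carrier G; y \<in> carrier G\<rbrakk> \<Longrightarrow> x \<otimes>\<^bsub>H\<^esub> y = shift (x \<otimes> y) (b x y)"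
  by (simp add: mult_H b_def)

lemma mult_z_H: "x \<in> carrier G \<Longrightarrow> x \<otimes>\<^bsub>H\<^esub> z = shift x 1"
  by (simp add: mult_H' b_simps mult_z)

lemma square_H: "x \<in> carrier G \<Longrightarrow> x \<otimes>\<^bsub>H\<^esub> x = shift \<one> (sq x + b x x)"
  by (simp add: mult_H' square_eq)

lemma commute_H:
  assumes "x \<in> carrier G" "y \<in> carrier G"
  shows "x \<otimes>\<^bsub>H\<^esub> y = shift (y \<otimes>\<^bsub>H\<^esub> x) (cm x y + b x y + b y x)"
proof -
  have "x \<otimes>\<^bsub>H\<^esub> y = shift (shift (y \<otimes> x) (cm x y)) (b x y)"
    using assms by (simp only: mult_H' commute[symmetric])
  then show ?thesis using assms by (simp add: mult_H' ac_simps)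
qed

text \<open>A bilinear form is a 2-cocycle: both bracketings acquire the same exponent b(x, y) +
  b(x, w) + b(y, w).\<close>

lemma associate_H:
  assumes "x \<in> carrier G" "y \<in> carrier G" "w \<in> carrier G"
  shows "x \<otimes>\<^bsub>H\<^esub> y \<otimes>\<^bsub>H\<^esub> w = shift (x \<otimes>\<^bsub>H\<^esub> (y \<otimes>\<^bsub>H\<^esub> w)) (as x y w)"
proof -
  have "x \<otimes>\<^bsub>H\<^esub> y \<otimes>\<^bsub>H\<^esub> w = shift (x \<otimes> y \<otimes> w) (b x y + b x w + b y w)"
    using assms by (simp add: mult_H' b_simps ac_simps)
  also have "x \<otimes> y \<otimes> w = shift (x \<otimes> (y \<otimes> w)) (as x y w)"
    using assms by (rule associate)
  finally show ?thesis
    using assms by (simp add: mult_H' b_simps ac_simps)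
qed

lemma shift_eq_shiftD:
  assumes "x \<in> carrier G" "y \<in> carrier G" "shift x p = shift y q"
  shows "y = shift x (p + q)"
  using assms(1,2) arg_cong[OF assms(3), of "\<lambda>u. shift u q"] by simp

sublocale H: symplectic H z
proof (intro symplectic.intro symplectic_axioms.intro)
  show "loop H"
  proof (rule finite_loopI)
    fix a x y assume axy: "a \<in> carrier H" "x \<in> carrier H" "y \<in> carrier H"
    \<comment> \<open>Equality of the shifted elements puts x and y in the same coset modulo z. As b
      depends only on cosets, the two shifts are equal and can be removed.\<close>
    have cancel: "x = y"
      if e: "shift x (b a x) = shift y (b a y) \<or> shift x (b x a) = shift y (b y a)"
    proof -
      obtain c where c: "y = shift x c"
        using e axy shift_eq_shiftD[of x y] unfolding carrier_H by blast
      then have "b a y = b a x" "b y a = b x a"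
        using axy by (simp_all add: carrier_H b_shift_left b_shift_right)
      then show ?thesis
        using e axy shift_eq_shiftD[of x y] unfolding carrier_H by (metis bit_add_self shift_0)
    qed
    show "x = y" if "a \<otimes>\<^bsub>H\<^esub> x = a \<otimes>\<^bsub>H\<^esub> y"
    proof -
      have "a \<otimes> shift x (b a x) = a \<otimes> shift y (b a y)"
        using that axy by (simp add: carrier_H mult_H')
      then have "shift x (b a x) = shift y (b a y)"
        using axy left_cancel[of a] by (simp add: carrier_H del: mult_shift)
      then show ?thesis using cancel by blast
    qed
    show "x = y" if "x \<otimes>\<^bsub>H\<^esub> a = y \<otimes>\<^bsub>H\<^esub> a"
    proof -
      have "shift x (b x a) \<otimes> a = shift y (b y a) \<otimes> a"
        using that axy by (simp add: carrier_H mult_H')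
      then have "shift x (b x a) = shift y (b y a)"
        using axy right_cancel[of a] by (simp add: carrier_H del: shift_mult)
      then show ?thesis using cancel by blast
    qed
  qed (simp_all add: carrier_H one_H mult_H' b_simps fin)
next
  fix x assume x: "x \<in> carrier H"
  show "x \<otimes>\<^bsub>H\<^esub> x = \<one>\<^bsub>H\<^esub> \<or> x \<otimes>\<^bsub>H\<^esub> x = z"
    using x shift_cases[of \<one>] by (simp add: carrier_H one_H square_H)
  show "z \<otimes>\<^bsub>H\<^esub> x = x \<otimes>\<^bsub>H\<^esub> z"
    using x by (simp add: carrier_H mult_H' b_simps z_comm)
next
  fix x y assume xy: "x \<in> carrier H" "y \<in> carrier H"
  then have yx: "y \<otimes>\<^bsub>H\<^esub> x \<in> carrier G"
    by (simp add: carrier_H mult_H')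
  show "x \<otimes>\<^bsub>H\<^esub> y = y \<otimes>\<^bsub>H\<^esub> x \<or> x \<otimes>\<^bsub>H\<^esub> y = y \<otimes>\<^bsub>H\<^esub> x \<otimes>\<^bsub>H\<^esub> z"
    using xy shift_cases[of "y \<otimes>\<^bsub>H\<^esub> x" "cm x y + b x y + b y x"] commute_H[of x y]
    unfolding mult_z_H[OF yx] mult_z[of "y \<otimes>\<^bsub>H\<^esub> x"] carrier_H by metis
  show "x \<otimes>\<^bsub>H\<^esub> (y \<otimes>\<^bsub>H\<^esub> z) = x \<otimes>\<^bsub>H\<^esub> y \<otimes>\<^bsub>H\<^esub> z" "x \<otimes>\<^bsub>H\<^esub> z \<otimes>\<^bsub>H\<^esub> y = x \<otimes>\<^bsub>H\<^esub> y \<otimes>\<^bsub>H\<^esub> z"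
    using xy by (simp_all add: carrier_H mult_z_H mult_H' b_simps z_right z_mid)
next
  fix x y w assume xyw: "x \<in> carrier H" "y \<in> carrier H" "w \<in> carrier H"
  then have m: "x \<otimes>\<^bsub>H\<^esub> (y \<otimes>\<^bsub>H\<^esub> w) \<in> carrier G"
    by (simp add: carrier_H mult_H')
  show "x \<otimes>\<^bsub>H\<^esub> y \<otimes>\<^bsub>H\<^esub> w = x \<otimes>\<^bsub>H\<^esub> (y \<otimes>\<^bsub>H\<^esub> w) \<or> x \<otimes>\<^bsub>H\<^esub> y \<otimes>\<^bsub>H\<^esub> w = x \<otimes>\<^bsub>H\<^esub> (y \<otimes>\<^bsub>H\<^esub> w) \<otimes>\<^bsub>H\<^esub> z"
    using xyw shift_cases[of "x \<otimes>\<^bsub>H\<^esub> (y \<otimes>\<^bsub>H\<^esub> w)" "as x y w"] associate_H[of x y w]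
    unfolding mult_z_H[OF m] mult_z[of "x \<otimes>\<^bsub>H\<^esub> (y \<otimes>\<^bsub>H\<^esub> w)"] carrier_H by metis
qed (simp_all add: carrier_H one_H fin z_z mult_H' b_simps)

text \<open>Since g vanishes at the class of z, multiplication by z is the same in both loops;
  therefore shifts and cosets agree.\<close>

lemma H_shift: "x \<in> carrier G \<Longrightarrow> H.shift x a = shift x a"
  by (simp add: H.shift_def mult_z_H shift_def)

lemma H_cl: "x \<in> carrier G \<Longrightarrow> H.cl x = cl x"
  by (simp add: H.cl_def mult_z_H cl_def mult_z)

lemma H_sq: "x \<in> carrier G \<Longrightarrow> H.sq x = sq x + b x x"
proof -
  have "to_gf2 H = to_gf2 G" by (simp add: fun_eq_iff to_gf2_def one_H)
  then show "x \<in> carrier G \<Longrightarrow> H.sq x = sq x + b x x"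
    by (simp add: H.sq_def square_H)
qed

lemma H_closed: "\<lbrakk>x \<in> carrier G; y \<in> carrier G\<rbrakk> \<Longrightarrow> x \<otimes>\<^bsub>H\<^esub> y \<in> carrier G"
  by (simp add: mult_H')

lemma H_cm:
  assumes "x \<in> carrier G" "y \<in> carrier G"
  shows "H.cm x y = cm x y + b x y + b y x"
  unfolding H.cm_eqI[of x y, unfolded carrier_H, OF assms,
      unfolded H_shift[OF H_closed[OF assms(2,1)]], OF commute_H[OF assms]] ..

lemma H_as:
  assumes "x \<in> carrier G" "y \<in> carrier G" "w \<in> carrier G"
  shows "H.as x y w = as x y w"
  unfolding H.as_eqI[of x y w, unfolded carrier_H, OF assms,
      unfolded H_shift[OF H_closed[OF assms(1) H_closed[OF assms(2,3)]]], OF associate_H[OF assms]] ..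

lemma H_sq_mult:
  "\<lbrakk>x \<in> carrier G; y \<in> carrier G\<rbrakk> \<Longrightarrow> H.sq (x \<otimes>\<^bsub>H\<^esub> y) = sq (x \<otimes> y) + b x x + b x y + b y x + b y y"
  by (simp add: mult_H' H_sq sq_shift b_simps ac_simps)

lemma H_sq_mult3:
  assumes "x \<in> carrier G" "y \<in> carrier G" "w \<in> carrier G"
  shows "H.sq (x \<otimes>\<^bsub>H\<^esub> y \<otimes>\<^bsub>H\<^esub> w) = sq (x \<otimes> y \<otimes> w) + b x x + b x y + b y x + b y y
    + b x w + b y w + b w x + b w y + b w w"
  using assms by (simp add: mult_H' H_sq sq_shift b_simps ac_simps)

lemma code_loop_H: "code_loop H Z"
proof -
  have "symplectic_code H z"
  proof (intro symplectic_code.intro symplectic_code_axioms.intro H.symplectic_axioms)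
    fix x y assume "x \<in> carrier H" "y \<in> carrier H"
    then show "H.cm x y = H.sq x + H.sq y + H.sq (x \<otimes>\<^bsub>H\<^esub> y)"
      by (simp add: carrier_H H_cm H_sq_mult H_sq cm_eq ac_simps)
  next
    fix x y w assume xyw: "x \<in> carrier H" "y \<in> carrier H" "w \<in> carrier H"
    then show "H.as x y w = H.sq x + H.sq y + H.sq w + H.sq (x \<otimes>\<^bsub>H\<^esub> y) + H.sq (x \<otimes>\<^bsub>H\<^esub> w)
        + H.sq (y \<otimes>\<^bsub>H\<^esub> w) + H.sq (x \<otimes>\<^bsub>H\<^esub> y \<otimes>\<^bsub>H\<^esub> w)"
      by (simp add: carrier_H H_as H_sq_mult H_sq_mult3 H_sq as_eq ac_simps)
  next
    fix x x' y w
    assume "x \<in> carrier H" "x' \<in> carrier H" "y \<in> carrier H" "w \<in> carrier H"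
    then show "H.as (x \<otimes>\<^bsub>H\<^esub> x') y w = H.as x y w + H.as x' y w"
      using as_shift[where b = 0 and c = 0] by (simp add: carrier_H H_as H_closed as_add mult_H')
  qed
  then show ?thesis using H.code_loop_iff by (simp add: one_H)
qed

text \<open>The quotient records multiply arbitrary subsets with the operations of two different
  loops. Agreement is claimed for cosets only, where the twist is invisible.\<close>

lemma same_loop_H: "same_loop (H Mod Z) V"
proof -
  have carrier: "carrier (H Mod Z) = carrier V"
    using H.carrier_V H_cl by (simp add: carrier_V carrier_H one_H)
  moreover have "u \<otimes>\<^bsub>H Mod Z\<^esub> v = u \<otimes>\<^bsub>V\<^esub> v" if uv: "u \<in> carrier V" "v \<in> carrier V" for u v
  proof -
    obtain x y where xy: "x \<in> carrier G" "y \<in> carrier G" "u = cl x" "v = cl y"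
      using uv by (auto elim!: carrier_V_E)
    have "H.cl x \<otimes>\<^bsub>H Mod Z\<^esub> H.cl y = H.cl (x \<otimes>\<^bsub>H\<^esub> y)"
      using H.mult_V[of x y] xy by (simp add: carrier_H one_H)
    then show ?thesis
      using xy by (simp add: H_cl H_closed mult_V) (simp add: mult_H')
  qed
  ultimately show ?thesis
    by (simp add: same_loop_def one_FactGroup del: one_V H.one_V)
qed

lemma power_map_H: "v \<in> carrier V \<Longrightarrow> power_map H v = power_map G v + g v v"
proof (elim carrier_V_E)
  fix x assume "x \<in> carrier G" "v = cl x"
  then show "power_map H v = power_map G v + g v v"
    using H.power_map_cl[of x] by (simp add: carrier_H H_cl H_sq power_map_cl) (simp add: b_def)
qed

end

section \<open>Quotients of a loop that are groups\<close>

locale loop_quotient = loop +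
  fixes S
  assumes subloop: "subloop S G"
    and group: "group (G Mod S)"
begin

abbreviation Q :: "'a set monoid" where
  "Q \<equiv> G Mod S"

sublocale Q: group Q
  by (rule group)

lemma one_Q: "\<one>\<^bsub>Q\<^esub> = S"
  by (simp add: FactGroup_def)

lemma S_closed: "S \<subseteq> carrier G" "\<one> \<in> S"
  using subloop loop.loop_one_closed[of "G\<lparr>carrier := S\<rparr>"] by (auto simp: subloop_def)

lemma coset_mem_Q: "x \<in> carrier G \<Longrightarrow> S #> x \<in> carrier Q"
  by (auto simp: FactGroup_def RCOSETS_def)

lemma mem_coset: "x \<in> carrier G \<Longrightarrow> x \<in> S #> x"
  using S_closed loop_l_one[of x] by (force simp: r_coset_def)

lemma mem_Q_mult: "\<lbrakk>x \<in> A; y \<in> B\<rbrakk> \<Longrightarrow> x \<otimes> y \<in> A \<otimes>\<^bsub>Q\<^esub> B"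
  by (auto simp: set_mult_def)

lemma Q_subset: "A \<in> carrier Q \<Longrightarrow> A \<subseteq> carrier G"
  using S_closed by (auto simp: FactGroup_def RCOSETS_def r_coset_def intro: loop_m_closed)

text \<open>If s and sd both lie in S, then division inside the subloop S puts d into S, and the
  coset of d is S.\<close>

lemma Q_meets_S:
  assumes A: "A \<in> carrier Q" and x: "x \<in> A" "x \<in> S"
  shows "A = S"
proof -
  interpret S: loop "G\<lparr>carrier := S\<rparr>"
    using subloop by (simp add: subloop_def)
  obtain d where d: "d \<in> carrier G" "A = S #> d"
    using A by (auto simp: FactGroup_def RCOSETS_def)
  then obtain s where s: "s \<in> S" "x = s \<otimes> d"
    using x by (auto simp: r_coset_def)
  obtain d' where "d' \<in> S" "s \<otimes> d' = x"
    using S.loop_left_division[of s x] s x by auto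
  then have dS: "d \<in> S"
    using left_cancel[of s d d'] s d S_closed by auto
  have "S \<subseteq> S #> d"
  proof
    fix y assume "y \<in> S"
    then obtain t where "t \<in> S" "t \<otimes> d = y"
      using S.loop_right_division[of d y] dS by auto
    then show "y \<in> S #> d" by (auto simp: r_coset_def)
  qed
  moreover have "S #> d \<subseteq> S"
    using S.loop_m_closed[of _ d] dS by (auto simp: r_coset_def)
  ultimately show ?thesis using d by blast
qed

text \<open>A common element c is multiplied on the left by some a in the inverse coset of A. The
  product lies in S and in the product of that inverse with B, so the latter equals S by
  \<open>Q_meets_S\<close>, and cancellation in the group gives A = B.\<close>

lemma Q_disjoint:
  assumes A: "A \<in> carrier Q" and B: "B \<in> carrier Q" and c: "c \<in> A" "c \<in> B"
  shows "A = B"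
proof -
  have inv: "inv\<^bsub>Q\<^esub> A \<in> carrier Q" using A by simp
  then obtain a where a: "a \<in> inv\<^bsub>Q\<^esub> A"
    using mem_coset by (auto simp: FactGroup_def RCOSETS_def)
  have "a \<otimes> c \<in> inv\<^bsub>Q\<^esub> A \<otimes>\<^bsub>Q\<^esub> A" "a \<otimes> c \<in> inv\<^bsub>Q\<^esub> A \<otimes>\<^bsub>Q\<^esub> B"
    using a c mem_Q_mult by blast+
  then have "inv\<^bsub>Q\<^esub> A \<otimes>\<^bsub>Q\<^esub> B = S"
    using Q_meets_S[of "inv\<^bsub>Q\<^esub> A \<otimes>\<^bsub>Q\<^esub> B"] A B by (simp add: Q.l_inv one_Q del: mult_FactGroup)
  then have "inv\<^bsub>Q\<^esub> A \<otimes>\<^bsub>Q\<^esub> B = inv\<^bsub>Q\<^esub> A \<otimes>\<^bsub>Q\<^esub> A"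
    using A by (simp add: Q.l_inv one_Q del: mult_FactGroup)
  then show ?thesis
    using A B inv Q.Units_l_cancel Q.Units_eq by metis
qed

lemma mem_Q_iff: "\<lbrakk>A \<in> carrier Q; x \<in> carrier G\<rbrakk> \<Longrightarrow> x \<in> A \<longleftrightarrow> S #> x = A"
  using Q_disjoint[of "S #> x" A x] coset_mem_Q mem_coset by auto

lemma coset_mult:
  "\<lbrakk>x \<in> carrier G; y \<in> carrier G\<rbrakk> \<Longrightarrow> S #> (x \<otimes> y) = (S #> x) \<otimes>\<^bsub>Q\<^esub> (S #> y)"
  using mem_Q_iff[of "(S #> x) \<otimes>\<^bsub>Q\<^esub> (S #> y)" "x \<otimes> y"] mem_Q_mult[of x "S #> x" y "S #> y"]
    coset_mem_Q mem_coset loop_m_closed Q.m_closed by blast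

lemma coset_of_S: "x \<in> S \<Longrightarrow> S #> x = \<one>\<^bsub>Q\<^esub>"
  using mem_Q_iff[of S x] S_closed Q.one_closed by (auto simp: one_Q)

lemma mem_l_coset:
  assumes "A \<in> carrier Q" "x \<in> carrier G" "e \<in> carrier G" "S #> x = (S #> e) \<otimes>\<^bsub>Q\<^esub> A"
  shows "x \<in> e <# A"
proof -
  obtain t where t: "t \<in> carrier G" "e \<otimes> t = x"
    using loop_left_division assms by blast
  then have "(S #> e) \<otimes>\<^bsub>Q\<^esub> (S #> t) = (S #> e) \<otimes>\<^bsub>Q\<^esub> A"
    using assms coset_mult by metis
  then have "S #> t = A"
    using assms t coset_mem_Q Q.Units_l_cancel Q.Units_eq by metis
  then show ?thesis
    using t mem_coset[of t] by (auto simp: l_coset_def)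
qed

lemma mem_r_coset:
  assumes "A \<in> carrier Q" "x \<in> carrier G" "f \<in> carrier G" "S #> x = A \<otimes>\<^bsub>Q\<^esub> (S #> f)"
  shows "x \<in> A #> f"
proof -
  obtain t where t: "t \<in> carrier G" "t \<otimes> f = x"
    using loop_right_division assms by blast
  then have "(S #> t) \<otimes>\<^bsub>Q\<^esub> (S #> f) = A \<otimes>\<^bsub>Q\<^esub> (S #> f)"
    using assms coset_mult by metis
  then have "S #> t = A"
    using assms t coset_mem_Q Q.right_cancel by metis
  then show ?thesis
    using t mem_coset[of t] by (auto simp: r_coset_def)
qed

end

section \<open>Loops obtained by the constructions\<close>

lemma twist_product:
  assumes "symplectic_code G z" "linear_form (G Mod {\<one>\<^bsub>G\<^esub>, z}) l" "linear_form (G Mod {\<one>\<^bsub>G\<^esub>, z}) k"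
    and "carrier H = carrier G" "\<one>\<^bsub>H\<^esub> = \<one>\<^bsub>G\<^esub>"
    and "\<And>x y. \<lbrakk>x \<in> carrier G; y \<in> carrier G\<rbrakk> \<Longrightarrow> x \<otimes>\<^bsub>H\<^esub> y
      = symplectic.shift G z (x \<otimes>\<^bsub>G\<^esub> y) (l (symplectic.cl G z x) * k (symplectic.cl G z y))"
  shows "twist G z H (\<lambda>u v. l u * k v)"
  using assms
  by (intro twist.intro twist_axioms.intro)
    (simp_all add: bilinear_form_def linear_form_def algebra_simps)

definition product_step :: "'a monoid \<Rightarrow> 'a \<Rightarrow> 'a monoid \<Rightarrow> bool" where
  "product_step G z H \<longleftrightarrow> (\<exists>l k.
    linear_form (G Mod {\<one>\<^bsub>G\<^esub>, z}) l \<and> linear_form (G Mod {\<one>\<^bsub>G\<^esub>, z}) k \<and>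
    twist G z H (\<lambda>u v. l u * k v))"

definition bit_int :: "bit \<Rightarrow> int" where
  "bit_int a = (if a = 0 then 0 else 1)"

lemma bit_int_mem: "bit_int a \<in> construction_range 1"
  by (simp add: bit_int_def construction_range_def)

lemma construction_range_1: "construction_range 1 = {0, 1}"
  by (auto simp: construction_range_def)

text \<open>With m = 1 a sum of two exponents leaves the range only as 1 + 1. This is where the
  product of two linear forms comes from.\<close>

lemma construction_sigma_bit_int:
  "construction_sigma 1 (bit_int a + bit_int b) = bit_int (a * b)"
  by (cases a; cases b) (simp_all add: bit_int_def construction_sigma_def)

context symplectic
begin

lemma inv_z: "inv z = z"
  unfolding m_inv_def
proof (rule the_equality)
  show "y = z" if "y \<in> carrier G \<and> z \<otimes> y = \<one> \<and> y \<otimes> z = \<one>" for y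
    using that left_cancel[of z y z] z_z by simp
qed (simp add: z_z)

text \<open>Negative powers are formed with \<open>m_inv\<close>, which fixes z by
  \<open>inv_z\<close>; hence the sign does not change the power.\<close>

lemma z_int_pow: "z [^] ((-1) ^ r * bit_int a) = shift \<one> a"
  by (cases "even r"; cases a)
    (simp_all add: bit_int_def shift_one_1 int_pow_def2 nat_pow_def inv_z)

lemma mult_z_int_pow: "x \<in> carrier G \<Longrightarrow> x \<otimes> (z [^] ((-1) ^ r * bit_int a)) = shift x a"
  by (simp add: z_int_pow)

lemma linear_form_lift:
  assumes hom: "\<And>x y. \<lbrakk>x \<in> carrier G; y \<in> carrier G\<rbrakk> \<Longrightarrow> l (x \<otimes> y) = l x + l y"
    and z: "l z = 0"
  obtains l' where "linear_form V l'" "\<And>x. x \<in> carrier G \<Longrightarrow> l' (cl x) = l x"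
proof -
  have l': "the_elem (l ` cl x) = l x" if "x \<in> carrier G" for x
    using that hom[of x z] z by (simp add: cl_def)
  have "linear_form V (\<lambda>v. the_elem (l ` v))"
    unfolding linear_form_def by (auto elim!: carrier_V_E simp: mult_V l' hom)
  then show ?thesis using l' that by blast
qed

text \<open>Squares lie in {1, z} and hence in S. In the resulting group every element is its own
  inverse, which forces commutativity.\<close>

lemma loop_quotient_elem_ab2:
  assumes "loop_quotient G S" "z \<in> S"
  shows "elem_ab2 (G Mod S)" "finite (carrier (G Mod S))"
proof -
  interpret loop_quotient G S by fact
  have carrier: "carrier Q = (\<lambda>x. S #> x) ` carrier G"
    by (auto simp: FactGroup_def RCOSETS_def)
  then show "finite (carrier Q)" using fin by simp
  have self: "A \<otimes>\<^bsub>Q\<^esub> A = \<one>\<^bsub>Q\<^esub>" if A: "A \<in> carrier Q" for A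
  proof -
    obtain x where x: "x \<in> carrier G" "A = S #> x" using A carrier by auto
    have "x \<otimes> x \<in> S" using square_mem[OF x(1)] S_closed assms(2) by auto
    then show ?thesis using x coset_mult[of x x] coset_of_S by simp
  qed
  show "elem_ab2 Q"
  proof (intro elem_ab2.intro elem_ab2_axioms.intro group.group_comm_groupI Q.group_axioms self)
    fix A B assume AB: "A \<in> carrier Q" "B \<in> carrier Q"
    have inv: "inv\<^bsub>Q\<^esub> X = X" if "X \<in> carrier Q" for X
      using that self by (intro Q.inv_equality)
    then show "A \<otimes>\<^bsub>Q\<^esub> B = B \<otimes>\<^bsub>Q\<^esub> A" using AB by (metis Q.inv_mult_group Q.m_closed)
  qed
qed

text \<open>Because z lies in S, a form on G/S is constant on cosets of Z. This moves the forms
  found in the quotient of a construction to V, where a twist needs them.\<close>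

lemma linear_form_pullback:
  assumes "loop_quotient G S" "z \<in> S" "linear_form (G Mod S) l"
  obtains l' where "linear_form V l'" "\<And>x. x \<in> carrier G \<Longrightarrow> l' (cl x) = l (S #> x)"
proof -
  interpret loop_quotient G S by fact
  have hom: "l (S #> (x \<otimes> y)) = l (S #> x) + l (S #> y)"
    if "x \<in> carrier G" "y \<in> carrier G" for x y
    using that assms(3) by (simp add: coset_mult coset_mem_Q linear_form_def)
  have "l (S #> z) = 0"
    using assms loop_quotient_elem_ab2(1) coset_of_S elem_ab2.linear_form_one by metis
  then show ?thesis
    using linear_form_lift[of "\<lambda>x. l (S #> x)"] hom that by blast
qed

end

context symplectic_code
begin

text \<open>By \<open>as_eq\<close> the vanishing associators say that P_3 vanishes when its first
  argument is the class of h. A trivial radical leaves only the class {1, z}, and h is not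
  1.\<close>

lemma radical_element:
  assumes rad: "radical3 V (\<lambda>u v w. derived_form V (power_map G) [u, v, w]) = {\<one>\<^bsub>V\<^esub>}"
    and h: "h \<in> carrier G" "h \<noteq> \<one>"
    and assoc: "\<And>x y. \<lbrakk>x \<in> carrier G; y \<in> carrier G\<rbrakk> \<Longrightarrow> loop_associator G h x y = \<one>"
  shows "h = z"
proof -
  have "derived_form V (power_map G) [cl h, cl x, cl y] = 0"
    if "x \<in> carrier G" "y \<in> carrier G" for x y
    using that h assoc[of x y] by (simp add: derived_power_map3 flip: as_eq) (simp add: as_def to_gf2_def)
  then have "cl h \<in> radical3 V (\<lambda>u v w. derived_form V (power_map G) [u, v, w])"
    using h by (auto simp: radical3_def elim!: carrier_V_E)
  then have "cl h = cl \<one>" using rad by simp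
  then show ?thesis using h(2) self_mem_cl[of h] by (auto simp: cl_one)
qed

end

text \<open>The constructions are only defined for records without further fields.\<close>

locale code_monoid = symplectic_code G z for G :: "'a monoid" (structure) and z
begin

lemma cyclic_construction_product_step:
  assumes rad: "radical3 V (\<lambda>u v w. derived_form V (power_map G) [u, v, w]) = {\<one>\<^bsub>V\<^esub>}"
    and C: "cyclic_construction m S \<alpha> h G H"
  shows "product_step G z H"
proof -
  interpret loop_quotient G S
    using C loop_axioms by (intro loop_quotient.intro loop_quotient_axioms.intro)
      (auto simp: cyclic_construction_def normal_subloop_def)
  have "h = z"
  proof (rule radical_element[OF rad])
    show "h \<in> carrier G" "h \<noteq> \<one>" using C S_closed by (auto simp: cyclic_construction_def)
    show "loop_associator G h x y = \<one>" if "x \<in> carrier G" "y \<in> carrier G" for x y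
      using that C by (auto simp: cyclic_construction_def loop_center_def)
  qed
  then have zS: "z \<in> S" using C by (auto simp: cyclic_construction_def)
  have lq: "loop_quotient G S" by (rule loop_quotient_axioms)
  interpret E: elem_ab2 Q by (rule loop_quotient_elem_ab2[OF lq zS])
  have \<alpha>: "\<alpha> \<in> carrier Q" and gen: "carrier Q = generate Q {\<alpha>}" and ord: "card (carrier Q) = 2 * m"
    and m: "1 \<le> m"
    using C by (auto simp: cyclic_construction_def order_def)
  \<comment> \<open>In exponent two, \<open>\<alpha>\<close> generates at most two elements;
    comparison with the order 2m yields m = 1.\<close>
  have "subgroup {\<one>\<^bsub>Q\<^esub>, \<alpha>} Q"
    using \<alpha> E.m_self by (intro E.subgroup_of_closed) (auto simp del: mult_FactGroup one_FactGroup)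
  then have carrier: "carrier Q \<subseteq> {\<one>\<^bsub>Q\<^esub>, \<alpha>}"
    unfolding gen by (intro Q.generate_subgroup_incl) auto
  then have "card (carrier Q) \<le> card {\<one>\<^bsub>Q\<^esub>, \<alpha>}" by (intro card_mono) auto
  then have m1: "m = 1" and \<alpha>1: "\<alpha> \<noteq> \<one>\<^bsub>Q\<^esub>" using ord m by (auto split: if_splits simp: card_insert_if)
  have "subgroup {\<one>\<^bsub>Q\<^esub>} Q" by (intro E.subgroup_of_closed) auto
  \<comment> \<open>On the two cosets this form is the exponent i in \<open>\<alpha>\<close> to the
    power i.\<close>
  then obtain l where l: "linear_form Q l" "l \<alpha> = 1"
    using E.ex_separating_linear_form[OF loop_quotient_elem_ab2(2)[OF lq zS], of "{\<one>\<^bsub>Q\<^esub>}" \<alpha>] \<alpha> \<alpha>1 by auto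
  obtain l' where l': "linear_form V l'" "\<And>x. x \<in> carrier G \<Longrightarrow> l' (cl x) = l (S #> x)"
    using linear_form_pullback[OF lq zS l(1)] by blast
  have mem: "x \<in> \<alpha> [^]\<^bsub>Q\<^esub> bit_int (l' (cl x))" if x: "x \<in> carrier G" for x
  proof -
    have "S #> x = \<one>\<^bsub>Q\<^esub> \<or> S #> x = \<alpha>"
      using coset_mem_Q[OF x] carrier by auto
    then have "S #> x = \<alpha> [^]\<^bsub>Q\<^esub> bit_int (l' (cl x))"
      using x l l' \<alpha> E.linear_form_one[OF l(1)] by (auto simp: bit_int_def)
    then show ?thesis using mem_coset[OF x] by simp
  qed
  have mult: "\<forall>i\<in>construction_range 1. \<forall>j\<in>construction_range 1.
      \<forall>x\<in>\<alpha> [^]\<^bsub>Q\<^esub> i. \<forall>y\<in>\<alpha> [^]\<^bsub>Q\<^esub> j. x \<otimes>\<^bsub>H\<^esub> y = x \<otimes> y \<otimes> z [^] construction_sigma 1 (i + j)"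
    using C unfolding cyclic_construction_def m1 \<open>h = z\<close> by blast
  have "twist G z H (\<lambda>u v. l' u * l' v)"
  proof (rule twist_product[OF symplectic_code_axioms l'(1) l'(1)])
    show "x \<otimes>\<^bsub>H\<^esub> y = shift (x \<otimes> y) (l' (cl x) * l' (cl y))"
      if xy: "x \<in> carrier G" "y \<in> carrier G" for x y
    proof -
      have "x \<otimes>\<^bsub>H\<^esub> y = x \<otimes> y \<otimes> z [^] construction_sigma 1 (bit_int (l' (cl x)) + bit_int (l' (cl y)))"
        using mult bit_int_mem mem xy by blast
      also have "\<dots> = shift (x \<otimes> y) (l' (cl x) * l' (cl y))"
        unfolding construction_sigma_bit_int using mult_z_int_pow[of "x \<otimes> y" 0] xy by simp
      finally show ?thesis .
    qed
  qed (use C in \<open>auto simp: cyclic_construction_def\<close>)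
  then show ?thesis using l'(1) by (auto simp: product_step_def)
qed

lemma dihedral_construction_product_step:
  assumes rad: "radical3 V (\<lambda>u v w. derived_form V (power_map G) [u, v, w]) = {\<one>\<^bsub>V\<^esub>}"
    and D: "dihedral_construction m S \<beta> \<gamma> h e f G H"
  shows "product_step G z H"
proof -
  define \<alpha> where "\<alpha> = \<beta> \<otimes>\<^bsub>G Mod S\<^esub> \<gamma>"
  define G0 where "G0 = (\<Union>i\<in>construction_range m. \<alpha> [^]\<^bsub>G Mod S\<^esub> i)"
  note D' = D[unfolded dihedral_construction_def Let_def, folded \<alpha>_def, folded G0_def]
  interpret loop_quotient G S
    using D' loop_axioms by (intro loop_quotient.intro loop_quotient_axioms.intro)
      (auto simp: dihedral_group_def normal_subloop_def)
  have "h = z"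
  proof (rule radical_element[OF rad])
    show "h \<in> carrier G" "h \<noteq> \<one>" using D' S_closed by auto
    show "loop_associator G h x y = \<one>" if "x \<in> carrier G" "y \<in> carrier G" for x y
      using that D' by (auto simp: nucleus_def)
  qed
  then have zS: "z \<in> S" using D' by auto
  have lq: "loop_quotient G S" by (rule loop_quotient_axioms)
  interpret E: elem_ab2 Q by (rule loop_quotient_elem_ab2[OF lq zS])
  note finQ = loop_quotient_elem_ab2(2)[OF lq zS]
  have \<beta>: "\<beta> \<in> carrier Q" "\<beta> \<noteq> \<one>\<^bsub>Q\<^esub>" and \<gamma>: "\<gamma> \<in> carrier Q" "\<gamma> \<noteq> \<one>\<^bsub>Q\<^esub>"
    and ord: "group.ord Q \<alpha> = 2 * m" and card: "card (carrier Q) = 2 * (2 * m)" and m: "1 \<le> m"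
    and e: "e \<in> \<beta>" and f: "f \<in> \<gamma>"
    using D' by (auto simp: involution_def dihedral_group_def order_def)
  have \<alpha>: "\<alpha> \<in> carrier Q" using \<beta> \<gamma> by (simp add: \<alpha>_def)
  \<comment> \<open>The order 2m of \<open>\<alpha>\<close> divides the exponent two, so m = 1 and
    the quotient is the Klein four-group.\<close>
  have "\<alpha> [^]\<^bsub>Q\<^esub> (2::nat) = \<one>\<^bsub>Q\<^esub>"
    using \<alpha> E.m_self by (simp add: numeral_2_eq_2)
  then have "2 * m dvd 2" using Q.pow_eq_id[OF \<alpha>] ord by metis
  then have "2 * m \<le> 2" by (rule dvd_imp_le) simp
  then have m1: "m = 1" using m by simp
  have \<alpha>1: "\<alpha> \<noteq> \<one>\<^bsub>Q\<^esub>" using ord m1 Q.ord_eq_1[OF \<alpha>] by auto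
  have \<beta>\<gamma>: "\<beta> \<noteq> \<gamma>" using \<alpha>1 E.m_self \<beta> by (auto simp: \<alpha>_def)
  have \<beta>\<alpha>: "\<beta> \<otimes>\<^bsub>Q\<^esub> \<alpha> = \<gamma>"
    using E.m_self_left[OF \<beta>(1) \<gamma>(1)] by (simp only: \<alpha>_def)
  have \<alpha>\<gamma>: "\<alpha> \<otimes>\<^bsub>Q\<^esub> \<gamma> = \<beta>"
    using E.m_self_left[OF \<gamma>(1) \<beta>(1)]
    by (simp only: E.m_comm[OF \<alpha> \<gamma>(1)]) (simp only: \<alpha>_def E.m_comm[OF \<beta>(1) \<gamma>(1)])
  have \<alpha>_ne: "\<alpha> \<noteq> \<beta>" "\<alpha> \<noteq> \<gamma>"
    using \<beta>\<alpha> \<alpha>\<gamma> \<beta>(2) \<gamma>(2) E.m_self[OF \<beta>(1)] E.m_self[OF \<gamma>(1)] by metis+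
  have carrier: "carrier Q = {\<one>\<^bsub>Q\<^esub>, \<beta>, \<gamma>, \<alpha>}"
  proof (rule card_subset_eq[symmetric])
    have "card {\<one>\<^bsub>Q\<^esub>, \<beta>, \<gamma>, \<alpha>} = 4"
      using \<beta> \<gamma> \<alpha>1 \<beta>\<gamma> \<alpha>_ne by auto
    then show "card {\<one>\<^bsub>Q\<^esub>, \<beta>, \<gamma>, \<alpha>} = card (carrier Q)" using card m1 by simp
  qed (use finQ \<beta> \<gamma> \<alpha> Q.one_closed in auto)
  have sub: "subgroup {\<one>\<^bsub>Q\<^esub>, \<delta>} Q" if "\<delta> \<in> carrier Q" for \<delta>
    using that E.m_self by (intro E.subgroup_of_closed) (auto simp del: mult_FactGroup one_FactGroup)
  \<comment> \<open>The left factor has exponent i = 0 on the cosets S and \<open>\<beta>\<close>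
    (the latter is e times S), and i = 1 on \<open>\<alpha>\<close> and \<open>\<gamma>\<close> =
    \<open>\<beta>\<close> \<open>\<alpha>\<close>; this is l. The right factor has j = 0 on S and
    \<open>\<gamma>\<close> (S times f), and j = 1 on \<open>\<alpha>\<close> and
    \<open>\<beta>\<close> = \<open>\<alpha>\<close> \<open>\<gamma>\<close>; this is k
    below.\<close>
  obtain l where l: "linear_form Q l" "\<And>u. u \<in> {\<one>\<^bsub>Q\<^esub>, \<beta>} \<Longrightarrow> l u = 0" "l \<gamma> = 1"
    using E.ex_separating_linear_form[OF finQ sub[OF \<beta>(1)] \<gamma>(1)] \<gamma> \<beta>\<gamma> by blast
  obtain k where k: "linear_form Q k" "\<And>u. u \<in> {\<one>\<^bsub>Q\<^esub>, \<gamma>} \<Longrightarrow> k u = 0" "k \<beta> = 1"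
    using E.ex_separating_linear_form[OF finQ sub[OF \<gamma>(1)] \<beta>(1)] \<beta> \<beta>\<gamma> by blast
  have l_vals: "l \<one>\<^bsub>Q\<^esub> = 0" "l \<beta> = 0" "l \<alpha> = 1" and k_vals: "k \<one>\<^bsub>Q\<^esub> = 0" "k \<gamma> = 0" "k \<alpha> = 1"
    using l k \<beta> \<gamma> unfolding \<alpha>_def linear_form_def by simp_all
  obtain l' where l': "linear_form V l'" "\<And>x. x \<in> carrier G \<Longrightarrow> l' (cl x) = l (S #> x)"
    using linear_form_pullback[OF lq zS l(1)] by blast
  obtain k' where k': "linear_form V k'" "\<And>x. x \<in> carrier G \<Longrightarrow> k' (cl x) = k (S #> x)"
    using linear_form_pullback[OF lq zS k(1)] by blast
  have eG: "e \<in> carrier G" "S #> e = \<beta>" and fG: "f \<in> carrier G" "S #> f = \<gamma>"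
    using e f \<beta> \<gamma> Q_subset mem_Q_iff by blast+
  have cases: "S #> x = \<one>\<^bsub>Q\<^esub> \<or> S #> x = \<beta> \<or> S #> x = \<gamma> \<or> S #> x = \<alpha>" if "x \<in> carrier G" for x
    using coset_mem_Q[OF that] carrier by auto
  have pow: "\<alpha> [^]\<^bsub>Q\<^esub> (0::int) = \<one>\<^bsub>Q\<^esub>" "\<alpha> [^]\<^bsub>Q\<^esub> (1::int) = \<alpha>"
    using \<alpha> by (simp_all only: int_pow_0 Q.int_pow_1)
  have mem_left: "x \<in> \<alpha> [^]\<^bsub>Q\<^esub> bit_int (l' (cl x)) \<union> (e <# (\<alpha> [^]\<^bsub>Q\<^esub> bit_int (l' (cl x))))"
    if x: "x \<in> carrier G" for x
    using cases[OF x]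
  proof (elim disjE)
    assume "S #> x = \<one>\<^bsub>Q\<^esub>"
    then show ?thesis using x mem_coset[OF x] l_vals l'(2) pow by (simp add: bit_int_def del: one_FactGroup)
  next
    assume "S #> x = \<alpha>"
    then show ?thesis using x mem_coset[OF x] l_vals l'(2) pow by (simp add: bit_int_def del: one_FactGroup)
  next
    assume "S #> x = \<beta>"
    then show ?thesis
      using x mem_l_coset[of "\<one>\<^bsub>Q\<^esub>" x e] eG \<beta> l_vals l'(2) pow
      by (simp add: bit_int_def del: one_FactGroup mult_FactGroup)
  next
    assume "S #> x = \<gamma>"
    then show ?thesis
      using x mem_l_coset[of \<alpha> x e] eG \<alpha> \<beta>\<alpha> l(3) l'(2) pow
      by (simp add: bit_int_def del: one_FactGroup mult_FactGroup)
  qed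
  have mem_right: "y \<in> \<alpha> [^]\<^bsub>Q\<^esub> bit_int (k' (cl y)) \<union> ((\<alpha> [^]\<^bsub>Q\<^esub> bit_int (k' (cl y))) #> f)"
    if y: "y \<in> carrier G" for y
    using cases[OF y]
  proof (elim disjE)
    assume "S #> y = \<one>\<^bsub>Q\<^esub>"
    then show ?thesis using y mem_coset[OF y] k_vals k'(2) pow by (simp add: bit_int_def del: one_FactGroup)
  next
    assume "S #> y = \<alpha>"
    then show ?thesis using y mem_coset[OF y] k_vals k'(2) pow by (simp add: bit_int_def del: one_FactGroup)
  next
    assume "S #> y = \<gamma>"
    then show ?thesis
      using y mem_r_coset[of "\<one>\<^bsub>Q\<^esub>" y f] fG \<gamma> k_vals k'(2) pow
      by (simp add: bit_int_def del: one_FactGroup mult_FactGroup)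
  next
    assume "S #> y = \<beta>"
    then show ?thesis
      using y mem_r_coset[of \<alpha> y f] fG \<alpha> \<alpha>\<gamma> k(3) k'(2) pow
      by (simp add: bit_int_def del: one_FactGroup mult_FactGroup)
  qed
  have mult: "x \<otimes>\<^bsub>H\<^esub> y = x \<otimes> y \<otimes> z [^] ((- 1) ^ r * construction_sigma 1 (i + j))"
    if "i \<in> construction_range 1" "j \<in> construction_range 1" "r \<in> {0, 1}"
      "x \<in> \<alpha> [^]\<^bsub>Q\<^esub> i \<union> (e <# (\<alpha> [^]\<^bsub>Q\<^esub> i))" "y \<in> \<alpha> [^]\<^bsub>Q\<^esub> j \<union> ((\<alpha> [^]\<^bsub>Q\<^esub> j) #> f)"
      "y \<in> (if r = 0 then G0 else carrier G - G0)" for i j r x y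
    using D' that unfolding m1 \<open>h = z\<close> by blast
  have "twist G z H (\<lambda>u v. l' u * k' v)"
  proof (rule twist_product[OF symplectic_code_axioms l'(1) k'(1)])
    show "x \<otimes>\<^bsub>H\<^esub> y = shift (x \<otimes> y) (l' (cl x) * k' (cl y))"
      if xy: "x \<in> carrier G" "y \<in> carrier G" for x y
    proof -
      define r where "r = (if y \<in> G0 then 0 else 1::nat)"
      have "x \<otimes>\<^bsub>H\<^esub> y = x \<otimes> y
          \<otimes> z [^] ((- 1) ^ r * construction_sigma 1 (bit_int (l' (cl x)) + bit_int (k' (cl y))))"
        by (rule mult[OF bit_int_mem bit_int_mem _ mem_left[OF xy(1)] mem_right[OF xy(2)]])
          (use xy in \<open>auto simp: r_def\<close>)
      also have "\<dots> = shift (x \<otimes> y) (l' (cl x) * k' (cl y))"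
        unfolding construction_sigma_bit_int using mult_z_int_pow[of "x \<otimes> y" r] xy by simp
      finally show ?thesis .
    qed
  qed (use D' in auto)
  then show ?thesis using l'(1) k'(1) by (auto simp: product_step_def)
qed

end

section \<open>Realizing a product of linear forms by a construction\<close>

text \<open>A surjective homomorphism onto an additive group makes the quotient by its kernel
  explicit: cosets are the fibres, and they multiply as their values add. The cyclic case takes
  values in GF(2), the dihedral case in pairs over GF(2).\<close>

locale loop_hom = symplectic +
  fixes \<psi> :: "'a \<Rightarrow> 'k :: ab_group_add"
  assumes hom: "\<lbrakk>x \<in> carrier G; y \<in> carrier G\<rbrakk> \<Longrightarrow> \<psi> (x \<otimes> y) = \<psi> x + \<psi> y"
    and surj: "\<exists>x\<in>carrier G. \<psi> x = a"
begin

definition fib :: "'k \<Rightarrow> 'a set" where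
  "fib a = {x \<in> carrier G. \<psi> x = a}"

lemma \<psi>_one: "\<psi> \<one> = 0"
  using hom[of \<one> \<one>] by simp

lemma mem_fib: "x \<in> fib a \<longleftrightarrow> x \<in> carrier G \<and> \<psi> x = a"
  by (simp add: fib_def)

lemma fib_inj: "fib a = fib b \<longleftrightarrow> a = b"
  using surj[of a] by (auto simp: fib_def)

lemma l_coset_fib: "x \<in> carrier G \<Longrightarrow> x <# fib a = fib (\<psi> x + a)"
proof
  assume x: "x \<in> carrier G"
  show "x <# fib a \<subseteq> fib (\<psi> x + a)" using x by (auto simp: l_coset_def mem_fib hom)
  show "fib (\<psi> x + a) \<subseteq> x <# fib a"
  proof
    fix y assume y: "y \<in> fib (\<psi> x + a)"
    then obtain t where t: "t \<in> carrier G" "x \<otimes> t = y"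
      using loop_left_division[OF x, of y] by (auto simp: mem_fib)
    then have "t \<in> fib a" using y hom[OF x t(1)] by (simp add: mem_fib)
    then show "y \<in> x <# fib a" using t by (auto simp: l_coset_def)
  qed
qed

lemma r_coset_fib: "x \<in> carrier G \<Longrightarrow> fib a #> x = fib (a + \<psi> x)"
proof
  assume x: "x \<in> carrier G"
  show "fib a #> x \<subseteq> fib (a + \<psi> x)" using x by (auto simp: r_coset_def mem_fib hom)
  show "fib (a + \<psi> x) \<subseteq> fib a #> x"
  proof
    fix y assume y: "y \<in> fib (a + \<psi> x)"
    then obtain t where t: "t \<in> carrier G" "t \<otimes> x = y"
      using loop_right_division[OF x, of y] by (auto simp: mem_fib)
    then have "t \<in> fib a" using y hom[OF t(1) x] by (simp add: mem_fib)
    then show "y \<in> fib a #> x" using t by (auto simp: r_coset_def)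
  qed
qed

abbreviation S :: "'a set" where
  "S \<equiv> fib 0"

abbreviation Q :: "'a set monoid" where
  "Q \<equiv> G Mod S"

lemma one_Q: "\<one>\<^bsub>Q\<^esub> = S"
  by (simp add: one_FactGroup)

lemma carrier_Q: "carrier Q = range fib"
proof -
  have "carrier Q = fib ` (\<psi> ` carrier G)"
    by (auto simp: FactGroup_def RCOSETS_def r_coset_fib)
  moreover have "\<psi> ` carrier G = UNIV"
    using surj by (metis UNIV_eq_I imageI)
  ultimately show ?thesis by simp
qed

lemma mult_Q: "fib a \<otimes>\<^bsub>Q\<^esub> fib b = fib (a + b)"
proof -
  have "fib a \<otimes>\<^bsub>Q\<^esub> fib b = (\<Union>x\<in>fib a. x <# fib b)"
    by (auto simp: mult_FactGroup set_mult_def l_coset_def)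
  also have "\<dots> = (\<Union>x\<in>fib a. fib (a + b))"
    by (intro SUP_cong refl) (simp add: mem_fib l_coset_fib)
  also have "\<dots> = fib (a + b)"
    using surj[of a] by (auto simp: mem_fib)
  finally show ?thesis .
qed

lemma loop_of_closed:
  assumes "A \<subseteq> carrier G" "\<one> \<in> A" "\<And>x y. \<lbrakk>x \<in> A; y \<in> A\<rbrakk> \<Longrightarrow> x \<otimes> y \<in> A"
  shows "loop (G\<lparr>carrier := A\<rparr>)"
proof (rule finite_loopI)
  fix a x y assume "a \<in> carrier (G\<lparr>carrier := A\<rparr>)" "x \<in> carrier (G\<lparr>carrier := A\<rparr>)"
    "y \<in> carrier (G\<lparr>carrier := A\<rparr>)"
  then have axy: "a \<in> carrier G" "x \<in> carrier G" "y \<in> carrier G" using assms(1) by auto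
  show "x = y" if "a \<otimes>\<^bsub>G\<lparr>carrier := A\<rparr>\<^esub> x = a \<otimes>\<^bsub>G\<lparr>carrier := A\<rparr>\<^esub> y"
    using left_cancel[OF axy] that by simp
  show "x = y" if "x \<otimes>\<^bsub>G\<lparr>carrier := A\<rparr>\<^esub> a = y \<otimes>\<^bsub>G\<lparr>carrier := A\<rparr>\<^esub> a"
    using right_cancel[OF axy] that by simp
qed (use assms finite_subset[OF assms(1) fin] in \<open>simp_all add: subset_iff\<close>)

lemma normal_subloop_S: "normal_subloop S G"
proof -
  have "loop (G\<lparr>carrier := S\<rparr>)"
    by (rule loop_of_closed) (auto simp: mem_fib \<psi>_one hom)
  then show ?thesis
    by (auto simp: normal_subloop_def subloop_def l_coset_fib r_coset_fib hom add.commute add.left_commute mem_fib)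
qed

lemma group_Q: "group Q"
proof (rule groupI)
  fix A assume "A \<in> carrier Q"
  then obtain a where "A = fib a" by (auto simp: carrier_Q)
  then have "fib (- a) \<otimes>\<^bsub>Q\<^esub> A = \<one>\<^bsub>Q\<^esub>" by (simp add: mult_Q one_Q)
  then show "\<exists>B\<in>carrier Q. B \<otimes>\<^bsub>Q\<^esub> A = \<one>\<^bsub>Q\<^esub>" by (auto simp: carrier_Q)
qed (auto simp: carrier_Q one_Q mult_Q add.assoc)

sublocale Q: group Q
  by (rule group_Q)

lemma order_Q: "order Q = card (UNIV :: 'k set)"
  by (simp add: order_def carrier_Q card_image inj_on_def fib_inj)

end

lemma UNIV_bit: "(UNIV :: bit set) = {0, 1}"
  by (auto simp flip: bit_not_zero_iff)

lemma UNIV_bit_prod: "(UNIV :: (bit \<times> bit) set) = {0, (1, 1), (0, 1), (1, 0)}"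
proof -
  have "(UNIV :: (bit \<times> bit) set) = {0, 1} \<times> {0, 1}"
    by (simp flip: UNIV_bit)
  then show ?thesis by (auto simp: zero_prod_def)
qed

context code_monoid
begin

definition twisted :: "('a set \<Rightarrow> bit) \<Rightarrow> ('a set \<Rightarrow> bit) \<Rightarrow> 'a monoid" where
  "twisted l k = \<lparr>carrier = carrier G, mult = \<lambda>x y. shift (x \<otimes> y) (l (cl x) * k (cl y)), one = \<one>\<rparr>"

lemma form_mult:
  "\<lbrakk>linear_form V l; x \<in> carrier G; y \<in> carrier G\<rbrakk> \<Longrightarrow> l (cl (x \<otimes> y)) = l (cl x) + l (cl y)"
  by (simp add: linear_form_def flip: mult_V)

lemma form_one: "linear_form V l \<Longrightarrow> l (cl \<one>) = 0"
  using V.linear_form_one[of l] by simp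

lemma cl_z_form: "linear_form V l \<Longrightarrow> l (cl z) = 0"
  by (simp add: cl_z form_one)

text \<open>The data are m = 1, h = z, S the kernel of l on G, and the generator the fibre over 1.
  The exponent of an element is then its value under l.\<close>

lemma cyclic_construction_twisted:
  assumes l: "linear_form V l" and v: "v \<in> carrier V" "l v = 1"
  shows "obtained_by_construction G (twisted l l)"
proof -
  interpret loop_hom G z "\<lambda>x. l (cl x)"
  proof
    show "l (cl (x \<otimes> y)) = l (cl x) + l (cl y)" if "x \<in> carrier G" "y \<in> carrier G" for x y
      using that by (simp add: form_mult[OF l])
    show "\<exists>x\<in>carrier G. l (cl x) = a" for a
      using v V.linear_form_one[OF l] by (cases a) (metis carrier_V_E loop_one_closed one_V)+
  qed
  have range: "carrier Q = {fib 0, fib 1}"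
    by (simp add: carrier_Q UNIV_bit)
  have pow: "fib 1 [^]\<^bsub>Q\<^esub> i = fib (if i = 0 then 0 else 1)" if "i \<in> {0, 1}" for i :: int
    using that Q.int_pow_1[of "fib 1"] range by (auto simp: one_Q)
  have gen: "carrier Q = generate Q {fib 1}"
  proof
    show "generate Q {fib 1} \<subseteq> carrier Q" using range by (intro Q.generate_incl) simp
    show "carrier Q \<subseteq> generate Q {fib 1}"
      unfolding range using generate.one[of Q "{fib 1}"] by (auto simp: one_Q intro: generate.incl)
  qed
  have ord: "order Q = 2 * 1"
    by (simp add: order_Q UNIV_bit)
  have center: "z \<in> S \<inter> loop_center G"
    using symplectic_loop cl_z_form[OF l]
    by (auto simp: mem_fib symplectic_loop_def central_subloop_def)
  have twisted: "x \<otimes>\<^bsub>twisted l l\<^esub> y = x \<otimes> y \<otimes> z [^] construction_sigma 1 (i + j)"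
    if "i \<in> construction_range 1" "j \<in> construction_range 1"
      "x \<in> fib 1 [^]\<^bsub>Q\<^esub> i" "y \<in> fib 1 [^]\<^bsub>Q\<^esub> j" for i j x y
  proof -
    have xy: "x \<in> carrier G" "y \<in> carrier G" "i = bit_int (l (cl x))" "j = bit_int (l (cl y))"
      using that pow unfolding construction_range_1 by (auto simp: mem_fib bit_int_def split: if_splits)
    show ?thesis
      unfolding xy(3,4) construction_sigma_bit_int
      using mult_z_int_pow[of "x \<otimes> y" 0] xy(1,2) by (simp add: twisted_def)
  qed
  have "fib 1 \<in> carrier Q" using range by simp
  then have "cyclic_construction 1 S (fib 1) z G (twisted l l)"
    unfolding cyclic_construction_def
    by (intro conjI ballI)
      (rule moufang normal_subloop_S group_Q gen ord center z_ne_one | assumption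
        | simp add: twisted_def; fail | rule twisted)+
  then show ?thesis unfolding obtained_by_construction_def by blast
qed

text \<open>Over GF(2), two distinct nonzero forms are linearly independent, so together they map
  onto all pairs.\<close>

lemma linear_forms_surj:
  assumes l: "linear_form V l" and k: "linear_form V k"
    and u: "u \<in> carrier V" "l u = 1" and v: "v \<in> carrier V" "k v = 1"
    and w: "w \<in> carrier V" "l w \<noteq> k w"
  shows "\<exists>x\<in>carrier V. (l x, k x) = a"
proof -
  have add: "l (x \<otimes>\<^bsub>V\<^esub> y) = l x + l y" "k (x \<otimes>\<^bsub>V\<^esub> y) = k x + k y"
    if "x \<in> carrier V" "y \<in> carrier V" for x y
    using l k that by (simp_all add: linear_form_def)
  note zero = V.linear_form_one[OF l] V.linear_form_one[OF k]
  \<comment> \<open>These vectors are dual to l and k. Each comes from u, v, w or from the sum of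
    two of them, depending on the remaining values of the forms.\<close>
  obtain p q where pq: "p \<in> carrier V" "l p = 1" "k p = 0" "q \<in> carrier V" "l q = 0" "k q = 1"
  proof (cases "k u = 0")
    case True
    note ku = this
    show ?thesis
    proof (cases "l v = 0")
      case True
      then show ?thesis using that[of u v] u v ku by simp
    next
      case False
      then show ?thesis using that[of u "u \<otimes>\<^bsub>V\<^esub> v"] u v ku add[OF u(1) v(1)] V.m_closed by simp
    qed
  next
    case False
    then have ku: "k u = 1" by simp
    show ?thesis
    proof (cases "l w = 0")
      case True
      then have "k w = 1" using w by (metis bit_not_zero_iff)
      then show ?thesis using that[of "u \<otimes>\<^bsub>V\<^esub> w" w] True u w ku add[OF u(1) w(1)] V.m_closed by simp
    next
      case False
      then have "l w = 1" "k w = 0" using w by auto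
      then show ?thesis using that[of w "u \<otimes>\<^bsub>V\<^esub> w"] u w ku add[OF u(1) w(1)] V.m_closed by simp
    qed
  qed
  obtain b c where a: "a = (b, c)" by (cases a)
  show ?thesis
    unfolding a
    using pq add[OF pq(1,4)] zero V.m_closed[OF pq(1,4)] V.one_closed
    by (cases b; cases c) (metis add_0 add_0_right)+
qed

text \<open>The quotient by the common kernel of l and k is the Klein four-group of value pairs,
  with \<open>\<alpha>\<close> = (1, 1), \<open>\<beta>\<close> = (0, 1), \<open>\<gamma>\<close> =
  (1, 0). Left multiplication by e in \<open>\<beta>\<close> does not change l, and right
  multiplication by f in \<open>\<gamma>\<close> does not change k, so l and k return the exponents
  i and j.\<close>

lemma dihedral_construction_twisted:
  assumes l: "linear_form V l" and k: "linear_form V k"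
    and u: "u \<in> carrier V" "l u = 1" and v: "v \<in> carrier V" "k v = 1"
    and w: "w \<in> carrier V" "l w \<noteq> k w"
  shows "obtained_by_construction G (twisted l k)"
proof -
  interpret loop_hom G z "\<lambda>x. (l (cl x), k (cl x))"
  proof
    show "(l (cl (x \<otimes> y)), k (cl (x \<otimes> y))) = (l (cl x), k (cl x)) + (l (cl y), k (cl y))"
      if "x \<in> carrier G" "y \<in> carrier G" for x y
      using that by (simp add: form_mult[OF l] form_mult[OF k])
    show "\<exists>x\<in>carrier G. (l (cl x), k (cl x)) = a" for a
      using linear_forms_surj[OF assms, of a] by (auto simp: carrier_V)
  qed
  let ?\<alpha> = "fib (1, 1)" and ?\<beta> = "fib (0, 1)" and ?\<gamma> = "fib (1, 0)"
  have range: "carrier Q = {S, ?\<alpha>, ?\<beta>, ?\<gamma>}"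
    unfolding carrier_Q UNIV_bit_prod by simp
  have order4: "order Q = 2 * (2 * 1)"
    unfolding order_Q UNIV_bit_prod by (simp add: zero_prod_def)
  have mult: "?\<beta> \<otimes>\<^bsub>Q\<^esub> ?\<gamma> = ?\<alpha>" "?\<alpha> \<otimes>\<^bsub>Q\<^esub> ?\<beta> = ?\<gamma>"
    by (simp_all add: mult_Q)
  have self: "fib a \<otimes>\<^bsub>Q\<^esub> fib a = \<one>\<^bsub>Q\<^esub>" for a
  proof -
    have "a + a = 0" by (cases a) (simp add: zero_prod_def)
    then show ?thesis by (simp add: mult_Q one_Q)
  qed
  have ne: "fib a \<noteq> \<one>\<^bsub>Q\<^esub>" if "a \<noteq> 0" for a
    using that by (simp add: one_Q fib_inj)
  have "?\<alpha> [^]\<^bsub>Q\<^esub> (2::nat) = \<one>\<^bsub>Q\<^esub>"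
    using self[of "(1, 1)"] range by (simp add: numeral_2_eq_2)
  then have "group.ord Q ?\<alpha> dvd 2" using Q.pow_eq_id[of ?\<alpha> 2] range by simp
  moreover have "group.ord Q ?\<alpha> \<noteq> 1"
    using Q.ord_eq_1[of ?\<alpha>] ne[of "(1, 1)"] range by (simp add: zero_prod_def)
  ultimately have ord: "group.ord Q ?\<alpha> = 2 * 1"
    using dvd_imp_le[of "group.ord Q ?\<alpha>" 2] by (cases "group.ord Q ?\<alpha> = 0") auto
  have gen: "carrier Q = generate Q {?\<alpha>, ?\<beta>}"
  proof
    show "generate Q {?\<alpha>, ?\<beta>} \<subseteq> carrier Q" using range by (intro Q.generate_incl) simp
    have "?\<gamma> \<in> generate Q {?\<alpha>, ?\<beta>}"
      unfolding mult(2)[symmetric] by (intro generate.eng generate.incl) simp_all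
    then show "carrier Q \<subseteq> generate Q {?\<alpha>, ?\<beta>}"
      unfolding range using generate.one[of Q "{?\<alpha>, ?\<beta>}"] by (auto simp: one_Q intro: generate.incl)
  qed
  have "(?\<beta> \<otimes>\<^bsub>Q\<^esub> ?\<alpha>) \<otimes>\<^bsub>Q\<^esub> ?\<beta> = inv\<^bsub>Q\<^esub> ?\<alpha>"
  proof -
    have "inv\<^bsub>Q\<^esub> ?\<alpha> = ?\<alpha>" using self range by (intro Q.inv_equality) simp_all
    then show ?thesis by (simp add: mult_Q)
  qed
  then have dihedral: "dihedral_group Q (2 * 1)"
    unfolding dihedral_group_def
    using Q.group_axioms order4 gen ord self[of "(0, 1)"] range by blast
  have inv: "involution Q ?\<beta>" "involution Q ?\<gamma>"
    using range self ne by (simp_all add: involution_def zero_prod_def)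
  define G0 where "G0 = (\<Union>i\<in>construction_range 1. ?\<alpha> [^]\<^bsub>Q\<^esub> i)"
  have pow: "?\<alpha> [^]\<^bsub>Q\<^esub> i = fib (if i = 0 then 0 else (1, 1))" if "i \<in> {0, 1}" for i :: int
    using that Q.int_pow_1[of ?\<alpha>] range by (auto simp: one_Q)
  have G0: "G0 = fib 0 \<union> ?\<alpha>"
    unfolding G0_def construction_range_1 by (simp add: pow)
  have zS: "z \<in> S"
    using cl_z_form[OF l] cl_z_form[OF k] by (simp add: mem_fib zero_prod_def)
  interpret G0: loop "G\<lparr>carrier := G0\<rparr>"
    unfolding G0 by (rule loop_of_closed)
      (auto simp: mem_fib zero_prod_def form_one[OF l] form_one[OF k] form_mult[OF l] form_mult[OF k])
  have G0_sub: "G0 \<subseteq> carrier G" "z \<in> G0" using zS by (auto simp: G0 mem_fib)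
  have center: "z \<in> loop_center (G\<lparr>carrier := G0\<rparr>)"
    using G0_sub G0.loop_commutator_eq_one_iff G0.loop_associator_eq_one_iff z_comm z_mid
    by (auto simp: loop_center_def subset_iff)
  have nucleus: "z \<in> nucleus G"
    by (auto simp: nucleus_def loop_associator_eq_one_iff z_comm z_mid)
  obtain e f where e: "e \<in> ?\<beta>" and f: "f \<in> ?\<gamma>"
    using surj[of "(0, 1)"] surj[of "(1, 0)"] by (auto simp: mem_fib)
  have "e \<in> carrier G - G0" using e by (auto simp: G0 mem_fib zero_prod_def)
  moreover have "(z \<otimes> e) \<otimes> z = e"
    using e by (simp add: mem_fib z_comm z_z_right)
  ultimately have ex: "\<exists>x\<in>carrier G - G0. (z \<otimes> x) \<otimes> z = x" by blast
  have twisted: "x \<otimes>\<^bsub>twisted l k\<^esub> y = x \<otimes> y \<otimes> z [^] ((- 1) ^ r * construction_sigma 1 (i + j))"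
    if "i \<in> construction_range 1" "j \<in> construction_range 1"
      "x \<in> ?\<alpha> [^]\<^bsub>Q\<^esub> i \<union> (e <# (?\<alpha> [^]\<^bsub>Q\<^esub> i))" "y \<in> ?\<alpha> [^]\<^bsub>Q\<^esub> j \<union> ((?\<alpha> [^]\<^bsub>Q\<^esub> j) #> f)"
    for i j r x y
  proof -
    have "x \<in> carrier G \<and> i = bit_int (l (cl x))" "y \<in> carrier G \<and> j = bit_int (k (cl y))"
      using that e f pow unfolding construction_range_1
      by (auto simp: mem_fib bit_int_def l_coset_fib r_coset_fib zero_prod_def split: if_splits)
    then have xy: "x \<in> carrier G" "y \<in> carrier G" "i = bit_int (l (cl x))" "j = bit_int (k (cl y))"
      by simp_all
    show ?thesis
      unfolding xy(3,4) construction_sigma_bit_int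
      using mult_z_int_pow[of "x \<otimes> y" r] xy(1,2) by (simp add: twisted_def)
  qed
  have "dihedral_construction 1 S ?\<beta> ?\<gamma> z e f G (twisted l k)"
    unfolding dihedral_construction_def Let_def mult(1) G0_def[symmetric]
  proof (intro conjI ballI)
    fix i j :: int and r :: nat and x y
    assume "i \<in> construction_range 1" "j \<in> construction_range 1"
      "x \<in> ?\<alpha> [^]\<^bsub>Q\<^esub> i \<union> (e <# (?\<alpha> [^]\<^bsub>Q\<^esub> i))"
      "y \<in> (?\<alpha> [^]\<^bsub>Q\<^esub> j \<union> ((?\<alpha> [^]\<^bsub>Q\<^esub> j) #> f)) \<inter> (if r = 0 then G0 else carrier G - G0)"
    then show "x \<otimes>\<^bsub>twisted l k\<^esub> y = x \<otimes> y \<otimes> z [^] ((- 1) ^ r * construction_sigma 1 (i + j))"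
      by (intro twisted) simp_all
  qed (rule moufang normal_subloop_S dihedral inv ord ex e f z_ne_one
      | simp add: twisted_def zS center nucleus; fail)+
  then show ?thesis unfolding obtained_by_construction_def by blast
qed

text \<open>If one form is zero, the product is zero and G itself serves. Equal nonzero forms call
  for the cyclic construction, distinct nonzero forms for the dihedral one.\<close>

lemma step_exists:
  assumes l: "linear_form V l" and k: "linear_form V k"
  obtains H where "H = G \<or> obtained_by_construction G H" "carrier H = carrier G" "code_loop H Z"
    "same_loop (H Mod Z) V" "\<And>v. v \<in> carrier V \<Longrightarrow> power_map H v = power_map G v + l v * k v"
proof (cases "(\<forall>v\<in>carrier V. l v = 0) \<or> (\<forall>v\<in>carrier V. k v = 0)")
  case True
  then show ?thesis using that[of G] code_loop by (auto simp: same_loop_def)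
next
  case False
  then obtain u v where uv: "u \<in> carrier V" "l u = 1" "v \<in> carrier V" "k v = 1" by auto
  \<comment> \<open>In the cyclic case k agrees with l on the carrier, but possibly not elsewhere;
    the second form is then replaced by l itself.\<close>
  obtain k' where k': "linear_form V k'" "\<forall>v\<in>carrier V. k' v = k v"
    and step: "obtained_by_construction G (twisted l k')"
  proof (cases "\<forall>w\<in>carrier V. l w = k w")
    case True
    then show ?thesis using that[of l] l cyclic_construction_twisted[OF l uv(1,2)] by blast
  next
    case False
    then show ?thesis using that[of k] k dihedral_construction_twisted[OF l k uv] by blast
  qed
  have "twist G z (twisted l k') (\<lambda>u v. l u * k' v)"
    by (rule twist_product[OF symplectic_code_axioms l k'(1)]) (simp_all add: twisted_def)
  then interpret T: twist G z "twisted l k'" "\<lambda>u v. l u * k' v" .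
  show ?thesis
    using that[of "twisted l k'"] step k'(2) T.carrier_H T.code_loop_H T.same_loop_H T.power_map_H
    by simp
qed

end

section \<open>Code loops are determined by their power map\<close>

context symplectic_code
begin

text \<open>A factor set t for a transversal s of Z. Its diagonal is P, its failure of symmetry is
  P_2 and its failure of the cocycle identity is P_3. All three defects depend on P alone, so they
  cancel in the difference of two factor sets with the same P.\<close>

lemma ex_cocycle:
  obtains s t where "\<And>v. v \<in> carrier V \<Longrightarrow> s v \<in> carrier G \<and> cl (s v) = v"
    and "\<And>u v. \<lbrakk>u \<in> carrier V; v \<in> carrier V\<rbrakk> \<Longrightarrow> s u \<otimes> s v = shift (s (u \<otimes>\<^bsub>V\<^esub> v)) (t u v)"
    and "\<And>v. v \<in> carrier V \<Longrightarrow> t \<one>\<^bsub>V\<^esub> v = 0"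
    and "\<And>v. v \<in> carrier V \<Longrightarrow> t v v = power_map G v"
    and "\<And>u v. \<lbrakk>u \<in> carrier V; v \<in> carrier V\<rbrakk>
      \<Longrightarrow> t u v = t v u + derived_form V (power_map G) [u, v]"
    and "\<And>u v w. \<lbrakk>u \<in> carrier V; v \<in> carrier V; w \<in> carrier V\<rbrakk>
      \<Longrightarrow> t u v + t (u \<otimes>\<^bsub>V\<^esub> v) w
        = t v w + t u (v \<otimes>\<^bsub>V\<^esub> w) + derived_form V (power_map G) [u, v, w]"
proof -
  \<comment> \<open>Representing the trivial class by 1 normalizes t, and gives t(v, v) = P(v)
    because v squares to the trivial class.\<close>
  define s where "s v = (if v = \<one>\<^bsub>V\<^esub> then \<one> else SOME x. x \<in> carrier G \<and> cl x = v)" for v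
  have s: "s v \<in> carrier G" "cl (s v) = v" if v: "v \<in> carrier V" for v
  proof -
    have "\<exists>x. x \<in> carrier G \<and> cl x = v" using v by (auto simp: carrier_V)
    then have "(SOME x. x \<in> carrier G \<and> cl x = v) \<in> carrier G \<and> cl (SOME x. x \<in> carrier G \<and> cl x = v) = v"
      by (rule someI_ex)
    then show "s v \<in> carrier G" "cl (s v) = v" by (auto simp: s_def)
  qed
  have s_one: "s \<one>\<^bsub>V\<^esub> = \<one>" by (simp add: s_def)
  have "\<exists>a. s u \<otimes> s v = shift (s (u \<otimes>\<^bsub>V\<^esub> v)) a" if uv: "u \<in> carrier V" "v \<in> carrier V" for u v
  proof -
    have "cl (s (u \<otimes>\<^bsub>V\<^esub> v)) = cl (s u \<otimes> s v)"
      using uv s mult_V[of "s u" "s v"] V.m_closed[of u v] by simp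
    then show ?thesis
      using uv s V.m_closed[of u v] cl_eq_iff by metis
  qed
  then obtain t where t: "\<And>u v. \<lbrakk>u \<in> carrier V; v \<in> carrier V\<rbrakk>
      \<Longrightarrow> s u \<otimes> s v = shift (s (u \<otimes>\<^bsub>V\<^esub> v)) (t u v)"
    by metis
  have t_eqI: "t u v = a"
    if "u \<in> carrier V" "v \<in> carrier V" "s u \<otimes> s v = shift (s (u \<otimes>\<^bsub>V\<^esub> v)) a" for u v a
    using t[OF that(1,2)] that s(1) V.m_closed[of u v] by simp
  show ?thesis
  proof (rule that[of s t])
    fix v assume v: "v \<in> carrier V"
    show "s v \<in> carrier G \<and> cl (s v) = v" using s v by blast
    show "t \<one>\<^bsub>V\<^esub> v = 0"
      using v s s_one by (intro t_eqI) (simp_all del: one_V)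
    have "sq (s v) = power_map G v"
      using power_map_cl[OF s(1)[OF v]] s(2)[OF v] by simp
    then show "t v v = power_map G v"
      using v s s_one square_eq[of "s v"] V.m_self[OF v] by (intro t_eqI) (simp_all del: one_V)
  next
    fix u v assume uv: "u \<in> carrier V" "v \<in> carrier V"
    then show "s u \<otimes> s v = shift (s (u \<otimes>\<^bsub>V\<^esub> v)) (t u v)" by (rule t)
    have "cm (s u) (s v) = derived_form V (power_map G) [cl (s u), cl (s v)]"
      using s(1) uv by (simp only: derived_power_map2 cm_eq)
    then have "cm (s u) (s v) = derived_form V (power_map G) [u, v]"
      using s uv by simp
    moreover have "s u \<otimes> s v = shift (s v \<otimes> s u) (cm (s u) (s v))"
      using s uv by (intro commute) simp_all
    ultimately show "t u v = t v u + derived_form V (power_map G) [u, v]"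
      using uv s V.m_comm[OF uv] by (intro t_eqI) (simp_all add: t[OF uv(2,1)])
  next
    fix u v w assume uvw: "u \<in> carrier V" "v \<in> carrier V" "w \<in> carrier V"
    have m: "u \<otimes>\<^bsub>V\<^esub> v \<in> carrier V" "v \<otimes>\<^bsub>V\<^esub> w \<in> carrier V" "u \<otimes>\<^bsub>V\<^esub> (v \<otimes>\<^bsub>V\<^esub> w) \<in> carrier V"
      using uvw by simp_all
    have "as (s u) (s v) (s w) = derived_form V (power_map G) [cl (s u), cl (s v), cl (s w)]"
      using s(1) uvw by (simp only: derived_power_map3 as_eq)
    then have as: "as (s u) (s v) (s w) = derived_form V (power_map G) [u, v, w]"
      using s uvw by simp
    have "s u \<otimes> s v \<otimes> s w = shift (s (u \<otimes>\<^bsub>V\<^esub> (v \<otimes>\<^bsub>V\<^esub> w))) (t u v + t (u \<otimes>\<^bsub>V\<^esub> v) w)"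
      using s uvw m by (simp add: t V.m_assoc ac_simps)
    moreover have "s u \<otimes> (s v \<otimes> s w) = shift (s (u \<otimes>\<^bsub>V\<^esub> (v \<otimes>\<^bsub>V\<^esub> w))) (t v w + t u (v \<otimes>\<^bsub>V\<^esub> w))"
      using s uvw m by (simp add: t ac_simps)
    moreover have "s u \<otimes> s v \<otimes> s w = shift (s u \<otimes> (s v \<otimes> s w)) (as (s u) (s v) (s w))"
      using s uvw by (intro associate) simp_all
    ultimately show "t u v + t (u \<otimes>\<^bsub>V\<^esub> v) w
        = t v w + t u (v \<otimes>\<^bsub>V\<^esub> w) + derived_form V (power_map G) [u, v, w]"
      using s m by (simp add: as)
  qed
qed

end

text \<open>The difference d of the two factor sets, compared along \<open>\<phi>\<close>, is a
  symmetric normalized cocycle with zero diagonal. It is the coboundary of some c, and correcting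
  the transversals by c turns \<open>\<phi>\<close> into an isomorphism of the loops.\<close>

lemma code_loop_unique:
  assumes "symplectic_code G z" "symplectic_code K w"
    and \<phi>: "\<phi> \<in> iso (G Mod {\<one>\<^bsub>G\<^esub>, z}) (K Mod {\<one>\<^bsub>K\<^esub>, w})"
    and P: "\<And>v. v \<in> carrier (G Mod {\<one>\<^bsub>G\<^esub>, z}) \<Longrightarrow> power_map G v = power_map K (\<phi> v)"
  shows "G \<cong> K"
proof -
  interpret G: symplectic_code G z by fact
  interpret K: symplectic_code K w by fact
  have \<phi>_closed: "\<phi> v \<in> carrier K.V" if "v \<in> carrier G.V" for v
    using \<phi> that by (auto simp: iso_def hom_def)
  have \<phi>_mult: "\<phi> (u \<otimes>\<^bsub>G.V\<^esub> v) = \<phi> u \<otimes>\<^bsub>K.V\<^esub> \<phi> v" if "u \<in> carrier G.V" "v \<in> carrier G.V" for u v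
    using \<phi> that by (simp add: iso_def hom_def)
  have \<phi>_bij: "bij_betw \<phi> (carrier G.V) (carrier K.V)"
    using \<phi> by (simp add: iso_def)
  have \<phi>_one: "\<phi> \<one>\<^bsub>G.V\<^esub> = \<one>\<^bsub>K.V\<^esub>"
    using \<phi> G.V.is_group K.V.is_group by (intro hom_one) (auto simp: iso_def)
  have derived: "derived_form G.V (power_map G) [u, v] = derived_form K.V (power_map K) [\<phi> u, \<phi> v]"
    "derived_form G.V (power_map G) [u, v, x] = derived_form K.V (power_map K) [\<phi> u, \<phi> v, \<phi> x]"
    if "u \<in> carrier G.V" "v \<in> carrier G.V" "x \<in> carrier G.V" for u v x
    using that \<phi>_closed
    by (simp_all add: G.V.derived_form2 G.V.derived_form3 K.V.derived_form2 K.V.derived_form3 P \<phi>_mult)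
  obtain s t where s: "\<And>v. v \<in> carrier G.V \<Longrightarrow> s v \<in> carrier G \<and> G.cl (s v) = v"
    and st: "\<And>u v. \<lbrakk>u \<in> carrier G.V; v \<in> carrier G.V\<rbrakk>
      \<Longrightarrow> s u \<otimes>\<^bsub>G\<^esub> s v = G.shift (s (u \<otimes>\<^bsub>G.V\<^esub> v)) (t u v)"
    and t: "\<And>v. v \<in> carrier G.V \<Longrightarrow> t \<one>\<^bsub>G.V\<^esub> v = 0"
      "\<And>v. v \<in> carrier G.V \<Longrightarrow> t v v = power_map G v"
      "\<And>u v. \<lbrakk>u \<in> carrier G.V; v \<in> carrier G.V\<rbrakk>
        \<Longrightarrow> t u v = t v u + derived_form G.V (power_map G) [u, v]"
      "\<And>u v x. \<lbrakk>u \<in> carrier G.V; v \<in> carrier G.V; x \<in> carrier G.V\<rbrakk>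
        \<Longrightarrow> t u v + t (u \<otimes>\<^bsub>G.V\<^esub> v) x
          = t v x + t u (v \<otimes>\<^bsub>G.V\<^esub> x) + derived_form G.V (power_map G) [u, v, x]"
    by (rule G.ex_cocycle) blast
  obtain s' t' where s': "\<And>v. v \<in> carrier K.V \<Longrightarrow> s' v \<in> carrier K \<and> K.cl (s' v) = v"
    and st': "\<And>u v. \<lbrakk>u \<in> carrier K.V; v \<in> carrier K.V\<rbrakk>
      \<Longrightarrow> s' u \<otimes>\<^bsub>K\<^esub> s' v = K.shift (s' (u \<otimes>\<^bsub>K.V\<^esub> v)) (t' u v)"
    and t': "\<And>v. v \<in> carrier K.V \<Longrightarrow> t' \<one>\<^bsub>K.V\<^esub> v = 0"
      "\<And>v. v \<in> carrier K.V \<Longrightarrow> t' v v = power_map K v"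
      "\<And>u v. \<lbrakk>u \<in> carrier K.V; v \<in> carrier K.V\<rbrakk>
        \<Longrightarrow> t' u v = t' v u + derived_form K.V (power_map K) [u, v]"
      "\<And>u v x. \<lbrakk>u \<in> carrier K.V; v \<in> carrier K.V; x \<in> carrier K.V\<rbrakk>
        \<Longrightarrow> t' u v + t' (u \<otimes>\<^bsub>K.V\<^esub> v) x
          = t' v x + t' u (v \<otimes>\<^bsub>K.V\<^esub> x) + derived_form K.V (power_map K) [u, v, x]"
    by (rule K.ex_cocycle) blast
  define d where "d u v = t u v + t' (\<phi> u) (\<phi> v)" for u v
  obtain c where c: "\<And>u v. \<lbrakk>u \<in> carrier G.V; v \<in> carrier G.V\<rbrakk> \<Longrightarrow> d u v = c u + c v + c (u \<otimes>\<^bsub>G.V\<^esub> v)"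
  proof (rule G.V.symmetric_cocycle_is_coboundary[OF G.finite_V, of d])
    fix u assume u: "u \<in> carrier G.V"
    show "d \<one>\<^bsub>G.V\<^esub> u = 0"
      unfolding d_def t(1)[OF u] \<phi>_one t'(1)[OF \<phi>_closed[OF u]] by simp
    show "d u u = 0"
      unfolding d_def t(2)[OF u] t'(2)[OF \<phi>_closed[OF u]] P[OF u] by simp
  next
    fix u v assume uv: "u \<in> carrier G.V" "v \<in> carrier G.V"
    show "d u v = d v u"
      unfolding d_def t(3)[OF uv] t'(3)[OF uv[THEN \<phi>_closed]] derived(1)[OF uv uv(1)]
      by (simp add: ac_simps)
  next
    fix u v x assume uvx: "u \<in> carrier G.V" "v \<in> carrier G.V" "x \<in> carrier G.V"
    have "d u v + d (u \<otimes>\<^bsub>G.V\<^esub> v) x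
        = (t u v + t (u \<otimes>\<^bsub>G.V\<^esub> v) x) + (t' (\<phi> u) (\<phi> v) + t' (\<phi> u \<otimes>\<^bsub>K.V\<^esub> \<phi> v) (\<phi> x))"
      using uvx by (simp add: d_def \<phi>_mult ac_simps)
    also have "\<dots> = t v x + t u (v \<otimes>\<^bsub>G.V\<^esub> x) + (t' (\<phi> v) (\<phi> x) + t' (\<phi> u) (\<phi> v \<otimes>\<^bsub>K.V\<^esub> \<phi> x))"
      unfolding t(4)[OF uvx] t'(4)[OF uvx[THEN \<phi>_closed]] derived(2)[OF uvx] by (simp add: ac_simps)
    finally show "d u v + d (u \<otimes>\<^bsub>G.V\<^esub> v) x = d v x + d u (v \<otimes>\<^bsub>G.V\<^esub> x)"
      using uvx by (simp add: d_def \<phi>_mult ac_simps)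
  qed blast
  have "\<exists>a. x = G.shift (s (G.cl x)) a" if x: "x \<in> carrier G" for x
  proof -
    have "G.cl (s (G.cl x)) = G.cl x" "s (G.cl x) \<in> carrier G" using s x by auto
    then show ?thesis using G.cl_eq_iff by metis
  qed
  then obtain e where e: "\<And>x. x \<in> carrier G \<Longrightarrow> x = G.shift (s (G.cl x)) (e x)" by metis
  \<comment> \<open>Every element is s(v) times z to the power e(x), with v its class; it is sent to
    s'(\<open>\<phi>\<close> v) times z to the power c(v) + e(x).\<close>
  define F where "F x = K.shift (s' (\<phi> (G.cl x))) (c (G.cl x) + e x)" for x
  have F_shift: "F (G.shift (s v) a) = K.shift (s' (\<phi> v)) (c v + a)" if v: "v \<in> carrier G.V" for v a
  proof -
    have sv: "s v \<in> carrier G" "G.cl (s v) = v" using s v by auto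
    then have "e (G.shift (s v) a) = a"
      using e[of "G.shift (s v) a"] by simp
    then show ?thesis using sv by (simp add: F_def)
  qed
  have repr: "\<exists>v a. v \<in> carrier G.V \<and> x = G.shift (s v) a" if "x \<in> carrier G" for x
    using e[OF that] G.cl_carrier_V[OF that] by blast
  have F_closed: "F x \<in> carrier K" if "x \<in> carrier G" for x
    using that s' \<phi>_closed by (simp add: F_def)
  have "F \<in> hom G K"
  proof (rule homI)
    fix x y assume "x \<in> carrier G" "y \<in> carrier G"
    then obtain u v a b where uv: "u \<in> carrier G.V" "v \<in> carrier G.V"
      and xy: "x = G.shift (s u) a" "y = G.shift (s v) b"
      using repr by meson
    have m: "u \<otimes>\<^bsub>G.V\<^esub> v \<in> carrier G.V" using uv by simp
    have "x \<otimes>\<^bsub>G\<^esub> y = G.shift (s (u \<otimes>\<^bsub>G.V\<^esub> v)) (t u v + a + b)"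
      using uv s m by (simp add: xy st ac_simps)
    then have "F (x \<otimes>\<^bsub>G\<^esub> y) = K.shift (s' (\<phi> u \<otimes>\<^bsub>K.V\<^esub> \<phi> v)) (c (u \<otimes>\<^bsub>G.V\<^esub> v) + (t u v + a + b))"
      using F_shift[OF m] uv by (simp add: \<phi>_mult)
    \<comment> \<open>As d is the sum of t and the transported t', adding d to t leaves the factor
      set of the target loop.\<close>
    also have "c (u \<otimes>\<^bsub>G.V\<^esub> v) = c u + c v + d u v"
      using c[OF uv] by (simp add: ac_simps)
    also have "K.shift (s' (\<phi> u \<otimes>\<^bsub>K.V\<^esub> \<phi> v)) (c u + c v + d u v + (t u v + a + b)) = F x \<otimes>\<^bsub>K\<^esub> F y"
      using uv s' \<phi>_closed K.V.m_closed[OF uv[THEN \<phi>_closed]]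
      by (simp add: xy F_shift st' d_def ac_simps)
    finally show "F (x \<otimes>\<^bsub>G\<^esub> y) = F x \<otimes>\<^bsub>K\<^esub> F y" .
  qed (rule F_closed)
  moreover have "bij_betw F (carrier G) (carrier K)"
  proof (rule bij_betwI')
    fix x y assume "x \<in> carrier G" "y \<in> carrier G"
    then obtain u v a b where uv: "u \<in> carrier G.V" "v \<in> carrier G.V"
      and xy: "x = G.shift (s u) a" "y = G.shift (s v) b"
      using repr by meson
    show "F x = F y \<longleftrightarrow> x = y"
    proof
      assume F: "F x = F y"
      then have eq: "K.shift (s' (\<phi> u)) (c u + a) = K.shift (s' (\<phi> v)) (c v + b)"
        using uv by (simp add: xy F_shift)
      then have "\<phi> u = \<phi> v"
        using uv s' \<phi>_closed by (metis K.cl_shift)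
      then have "u = v"
        using uv \<phi>_bij by (meson bij_betw_def inj_onD)
      then show "x = y"
        using eq uv s' \<phi>_closed by (simp add: xy)
    qed simp
  next
    fix y assume y: "y \<in> carrier K"
    obtain v where v: "v \<in> carrier G.V" "\<phi> v = K.cl y"
      using \<phi>_bij K.cl_carrier_V[OF y] by (metis bij_betw_def imageE)
    have "K.cl (s' (\<phi> v)) = K.cl y" "s' (\<phi> v) \<in> carrier K"
      using s' v y by auto
    then obtain a where "y = K.shift (s' (\<phi> v)) a"
      using K.cl_eq_iff by metis
    then have "y = F (G.shift (s v) (c v + a))"
      using v by (simp add: F_shift)
    then show "\<exists>x\<in>carrier G. y = F x" using s v by auto
  qed (rule F_closed)
  ultimately show ?thesis by (auto simp: is_iso_def iso_def)
qed

section \<open>Sequences of constructions\<close>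

lemma same_loop_linear_form:
  "same_loop L V \<Longrightarrow> linear_form L l \<longleftrightarrow> linear_form V l"
  by (simp add: same_loop_def linear_form_def)

lemma same_loop_trans: "\<lbrakk>same_loop K L; same_loop L M\<rbrakk> \<Longrightarrow> same_loop K M"
  by (auto simp: same_loop_def)

lemma same_loop_derived_form3:
  assumes "elem_ab2 L" "elem_ab2 V" "same_loop L V"
    and uvw: "u \<in> carrier V" "v \<in> carrier V" "w \<in> carrier V"
  shows "derived_form L f [u, v, w] = derived_form V f [u, v, w]"
proof -
  interpret L: elem_ab2 L by fact
  interpret V: elem_ab2 V by fact
  show ?thesis
    using assms(3) uvw by (simp add: L.derived_form3 V.derived_form3 same_loop_def)
qed

definition reachable :: "'a monoid \<Rightarrow> 'a monoid \<Rightarrow> bool" where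
  "reachable G K \<longleftrightarrow> (\<exists>s H. construction_sequence G s H \<and> H s = K)"

lemma reachable_refl: "reachable G G"
  unfolding reachable_def construction_sequence_def
  by (intro exI[of _ 0] exI[of _ "\<lambda>_. G"]) simp

lemma reachable_step:
  assumes "reachable G K" "obtained_by_construction K L"
  shows "reachable G L"
proof -
  obtain s H where "construction_sequence G s H" "H s = K"
    using assms(1) by (auto simp: reachable_def)
  then have "construction_sequence G (Suc s) (H(Suc s := L))"
    using assms(2) by (auto simp: construction_sequence_def less_Suc_eq)
  then show ?thesis unfolding reachable_def by (metis fun_upd_same)
qed

text \<open>Each summand l * k costs at most one construction. The next step starts from the loop
  reached so far, whose quotient agrees with that of G on the carrier, so l and k remain linear
  forms there.\<close>

lemma reachable_quadratic:
  assumes G: "code_loop G Z" and q: "quadratic_form (G Mod Z) q"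
  shows "\<exists>K. reachable G K \<and> carrier K = carrier G \<and> code_loop K Z \<and> same_loop (K Mod Z) (G Mod Z) \<and>
    (\<forall>v\<in>carrier (G Mod Z). power_map K v = power_map G v + q v)"
  using q
proof induction
  case zero
  then show ?case
    using G by (intro exI[of _ G]) (simp add: reachable_refl same_loop_def)
next
  case (add q l k)
  then obtain K where K: "reachable G K" "carrier K = carrier G" "code_loop K Z"
    "same_loop (K Mod Z) (G Mod Z)"
    "\<And>v. v \<in> carrier (G Mod Z) \<Longrightarrow> power_map K v = power_map G v + q v"
    by blast
  obtain z where z: "Z = {\<one>\<^bsub>K\<^esub>, z}" "symplectic_code K z" using K(3) by (rule code_loopE)
  interpret K: code_monoid K z using z(2) by (rule code_monoid.intro)
  have "linear_form K.V l" "linear_form K.V k"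
    using add.hyps K(4) same_loop_linear_form unfolding z(1) by blast+
  then obtain H where H: "H = K \<or> obtained_by_construction K H" "carrier H = carrier K"
    "code_loop H Z" "same_loop (H Mod Z) (K Mod Z)"
    "\<And>v. v \<in> carrier (K Mod Z) \<Longrightarrow> power_map H v = power_map K v + l v * k v"
    unfolding z(1) by (rule K.step_exists) blast
  have "reachable G H" using H(1) K(1) reachable_step by blast
  moreover have "power_map H v = power_map G v + (q v + l v * k v)" if "v \<in> carrier (G Mod Z)" for v
    using that H(5)[of v] K(4,5) by (simp add: same_loop_def add.assoc)
  ultimately show ?case
    using H K same_loop_trans by (intro exI[of _ H]) auto
qed

text \<open>The quadratic form q is carried through the induction because its third derived form is
  zero: P_3 and its radical stay those of G, so the trivial radical can be used again at the next
  step.\<close>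

lemma construction_sequence_quadratic:
  assumes G: "code_loop G Z"
    and rad: "radical3 (G Mod Z) (\<lambda>u v w. derived_form (G Mod Z) (power_map G) [u, v, w]) = {\<one>\<^bsub>G Mod Z\<^esub>}"
    and H: "construction_sequence G s H" and "i \<le> s"
  shows "carrier (H i) = carrier G \<and> code_loop (H i) Z \<and> same_loop (H i Mod Z) (G Mod Z) \<and>
    (\<exists>q. quadratic_form (G Mod Z) q \<and>
      (\<forall>v\<in>carrier (G Mod Z). power_map (H i) v = power_map G v + q v))"
  using \<open>i \<le> s\<close>
proof (induction i)
  case 0
  then show ?case
    using G H by (auto simp: construction_sequence_def same_loop_def intro!: exI[of _ "\<lambda>_. 0"] quadratic_form.zero)
next
  case (Suc i)
  let ?K = "H i" and ?V = "G Mod Z"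
  obtain q where K: "carrier ?K = carrier G" "code_loop ?K Z" "same_loop (?K Mod Z) ?V"
    and q: "quadratic_form ?V q" "\<And>v. v \<in> carrier ?V \<Longrightarrow> power_map ?K v = power_map G v + q v"
    using Suc by auto
  obtain z where z: "Z = {\<one>\<^bsub>?K\<^esub>, z}" "symplectic_code ?K z" using K(2) by (rule code_loopE)
  interpret K: code_monoid ?K z using z(2) by (rule code_monoid.intro)
  interpret V: elem_ab2 ?V
    using G by (simp add: code_loop_def symplectic_loop_def elem_ab2_iff)
  have KV: "K.V = ?K Mod Z" by (simp add: z(1))
  \<comment> \<open>The derived form is first moved to the quotient of G; there the contribution of
    q to P_3 vanishes.\<close>
  have derived: "derived_form K.V (power_map ?K) [u, v, w] = derived_form ?V (power_map G) [u, v, w]"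
    if uvw: "u \<in> carrier ?V" "v \<in> carrier ?V" "w \<in> carrier ?V" for u v w
  proof -
    have "derived_form K.V (power_map ?K) [u, v, w] = derived_form ?V (power_map ?K) [u, v, w]"
      using K(3) uvw by (intro same_loop_derived_form3 K.V.elem_ab2_axioms V.elem_ab2_axioms) (simp_all add: KV)
    also have "\<dots> = derived_form ?V (power_map G) [u, v, w] + derived_form ?V q [u, v, w]"
      using uvw by (simp add: V.derived_form3 q(2) ac_simps)
    finally show ?thesis using V.quadratic_form_derived[OF q(1) uvw] by simp
  qed
  have carrier: "carrier K.V = carrier ?V" and one: "\<one>\<^bsub>K.V\<^esub> = \<one>\<^bsub>?V\<^esub>"
    using K(3) unfolding KV same_loop_def by simp_all
  have "radical3 K.V (\<lambda>u v w. derived_form K.V (power_map ?K) [u, v, w])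
      = radical3 ?V (\<lambda>u v w. derived_form ?V (power_map G) [u, v, w])"
    unfolding radical3_def carrier using derived by auto
  then have rad': "radical3 K.V (\<lambda>u v w. derived_form K.V (power_map ?K) [u, v, w]) = {\<one>\<^bsub>K.V\<^esub>}"
    using rad one by simp
  have "obtained_by_construction ?K (H (Suc i))"
    using H Suc.prems by (simp add: construction_sequence_def)
  then have "product_step ?K z (H (Suc i))"
    unfolding obtained_by_construction_def
    using K.cyclic_construction_product_step[OF rad'] K.dihedral_construction_product_step[OF rad'] by blast
  then obtain l k where lk: "linear_form K.V l" "linear_form K.V k"
    and "twist ?K z (H (Suc i)) (\<lambda>u v. l u * k v)"
    by (auto simp: product_step_def)
  then interpret T: twist ?K z "H (Suc i)" "\<lambda>u v. l u * k v" by simp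
  have "linear_form ?V l" "linear_form ?V k"
    using lk K(3) same_loop_linear_form unfolding KV by blast+
  then have "quadratic_form ?V (\<lambda>v. q v + l v * k v)"
    using q(1) by (intro quadratic_form.add)
  moreover have "power_map (H (Suc i)) v = power_map G v + (q v + l v * k v)" if "v \<in> carrier ?V" for v
    using that T.power_map_H[of v] q(2)[of v] carrier by (simp add: add.assoc)
  ultimately have "\<exists>q. quadratic_form ?V q
      \<and> (\<forall>v\<in>carrier ?V. power_map (H (Suc i)) v = power_map G v + q v)"
    by blast
  moreover have "carrier (H (Suc i)) = carrier G"
    using T.carrier_H K(1) by simp
  moreover have "code_loop (H (Suc i)) Z"
    using T.code_loop_H unfolding z(1)[symmetric] .
  moreover have "same_loop (H (Suc i) Mod Z) ?V"
    using T.same_loop_H K(3) unfolding z(1)[symmetric] by (rule same_loop_trans)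
  ultimately show ?case by blast
qed

theorem proposition8p7:
  fixes G :: "'a monoid" and Z :: "'a set"
    and V :: "'a set monoid" and P :: "'a set \<Rightarrow> bit"
  assumes "code_loop G Z" and "V = G Mod Z" and "P = power_map G"
  shows
    "(\<forall>s H. construction_sequence G s H \<and>
        radical3 V (\<lambda>u v w. derived_form V P [u, v, w]) = {\<one>\<^bsub>V\<^esub>} \<longrightarrow>
        carrier (H s) = carrier G \<and> code_loop (H s) Z \<and> same_loop (H s Mod Z) V \<and>
        cdeg V (\<lambda>v. power_map (H s) v - P v) \<le> 2) \<and>
     (\<forall>(K :: 'b monoid) R. is_code_loop_VFP K V R \<and> cdeg V (\<lambda>v. R v - P v) \<le> 2 \<longrightarrow>
        (\<exists>s H. construction_sequence G s H \<and> H s \<cong> K))"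
proof -
  obtain z where z: "Z = {\<one>\<^bsub>G\<^esub>, z}" "symplectic_code G z" using assms(1) by (rule code_loopE)
  interpret G: symplectic_code G z by (rule z(2))
  have V: "V = G.V" using assms(2) z(1) by simp
  interpret V: elem_ab2 V unfolding V by (rule G.V.elem_ab2_axioms)
  have finV: "finite (carrier V)" unfolding V by (rule G.finite_V)
  have P1: "P \<one>\<^bsub>V\<^esub> = 0" unfolding V assms(3) by (rule G.power_map_one)
  have part1: "carrier (H s) = carrier G \<and> code_loop (H s) Z \<and> same_loop (H s Mod Z) V \<and>
      cdeg V (\<lambda>v. power_map (H s) v - P v) \<le> 2"
    if H: "construction_sequence G s H"
      and rad: "radical3 V (\<lambda>u v w. derived_form V P [u, v, w]) = {\<one>\<^bsub>V\<^esub>}" for s H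
  proof -
    obtain q where *: "carrier (H s) = carrier G" "code_loop (H s) Z" "same_loop (H s Mod Z) V"
      and q: "quadratic_form V q" "\<And>v. v \<in> carrier V \<Longrightarrow> power_map (H s) v = P v + q v"
      using construction_sequence_quadratic[OF assms(1) _ H order_refl] rad
      unfolding assms(2,3) by blast
    let ?f = "\<lambda>v. power_map (H s) v - P v"
    \<comment> \<open>In characteristic two the difference with P is the sum with P, so P
      cancels.\<close>
    have f: "?f v = q v" if "v \<in> carrier V" for v
      using q(2)[OF that] by (simp add: ac_simps)
    have "?f \<one>\<^bsub>V\<^esub> = 0"
      using f[OF V.one_closed] V.quadratic_form_derived[OF q(1)] V.one_closed by metis
    moreover have "derived_form V ?f [u, v, w] = 0"
      if "u \<in> carrier V" "v \<in> carrier V" "w \<in> carrier V" for u v w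
    proof -
      have "derived_form V ?f [u, v, w] = derived_form V q [u, v, w]"
        unfolding V.derived_form3[OF that] using that by (simp only: f V.m_closed)
      then show ?thesis using V.quadratic_form_derived[OF q(1) that] by simp
    qed
    ultimately have "cdeg V ?f \<le> 2"
      using V.cdeg_le_2_iff[where f = ?f, OF finV] by blast
    then show ?thesis using * by blast
  qed
  have part2: "\<exists>s H. construction_sequence G s H \<and> H s \<cong> K"
    if vfp: "is_code_loop_VFP K V R" and cdeg: "cdeg V (\<lambda>v. R v - P v) \<le> 2" for K :: "'b monoid" and R
  proof -
    obtain W \<phi> where K: "code_loop K W" and \<phi>: "\<phi> \<in> iso V (K Mod W)"
      and R: "\<And>v. v \<in> carrier V \<Longrightarrow> R v = power_map K (\<phi> v)"
      using vfp by (auto simp: is_code_loop_VFP_def)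
    obtain w where w: "W = {\<one>\<^bsub>K\<^esub>, w}" "symplectic_code K w" using K by (rule code_loopE)
    interpret K: symplectic_code K w by (rule w(2))
    \<comment> \<open>R is prescribed through \<open>\<phi>\<close> on the carrier; its value 0 at
      the identity, required by the degree criterion, follows from \<open>\<phi>\<close> preserving
      the identity.\<close>
    have "\<phi> \<one>\<^bsub>V\<^esub> = \<one>\<^bsub>K.V\<^esub>"
      using \<phi> V.is_group K.V.is_group unfolding w(1) by (intro hom_one) (auto simp: iso_def)
    then have "R \<one>\<^bsub>V\<^esub> = 0"
      using R[OF V.one_closed] K.power_map_one by simp
    then have f1: "R \<one>\<^bsub>V\<^esub> - P \<one>\<^bsub>V\<^esub> = 0" using P1 by simp
    have "derived_form V (\<lambda>v. R v - P v) [u, v, w] = 0"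
      if "u \<in> carrier V" "v \<in> carrier V" "w \<in> carrier V" for u v w
      using cdeg that unfolding V.cdeg_le_2_iff[where f = "\<lambda>v. R v - P v", OF finV f1] by blast
    then obtain q where q: "quadratic_form V q" "\<And>v. v \<in> carrier V \<Longrightarrow> R v - P v = q v"
      using V.quadratic_form_exists[OF finV, of "\<lambda>v. R v - P v"] f1 by blast
    \<comment> \<open>Starting from G and adding q = R - P produces a loop with power map R on the
      carrier of V; uniqueness then identifies it with K.\<close>
    obtain L where L: "reachable G L" "code_loop L Z" "same_loop (L Mod Z) V"
      "\<And>v. v \<in> carrier V \<Longrightarrow> power_map L v = P v + q v"
      using reachable_quadratic[OF assms(1), of q] q(1) unfolding assms(2,3) by blast
    obtain y where y: "Z = {\<one>\<^bsub>L\<^esub>, y}" "symplectic_code L y" using L(2) by (rule code_loopE)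
    \<comment> \<open>Being an isomorphism depends only on the operation on the carrier, where the
      quotient of L agrees with V.\<close>
    have "\<phi> \<in> iso (L Mod Z) (K Mod W)"
      using \<phi> L(3) by (auto simp: iso_def hom_def same_loop_def Pi_iff)
    moreover have "power_map L v = power_map K (\<phi> v)" if "v \<in> carrier (L Mod Z)" for v
    proof -
      have v: "v \<in> carrier V" using that L(3) by (simp add: same_loop_def)
      have "power_map L v = P v + (R v - P v)" using L(4)[OF v] q(2)[OF v] by simp
      then show ?thesis using R[OF v] by (simp add: ac_simps)
    qed
    ultimately have "L \<cong> K"
      unfolding w(1) y(1) by (intro code_loop_unique[OF y(2) w(2)])
    then show ?thesis using L(1) by (auto simp: reachable_def)
  qed
  show ?thesis using part1 part2 by blast
qed

end
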